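(* There exists a constant $C=C(\pi,q,\delta)$ such that the following holds for the broadcast process with transition matrix $P$ satisfying $\|P_i-P_j\|_1\ge\delta q\lambda_2$ for all $i\ne j$ ($P_i$ the $i$-th row) and with invertible noise matrix $\Delta$. If the communities are $\delta$-distinguishable by $\{\xi_i:\lambda_i^2d>C\}$, then there exists $k_0=k_0(d,\lambda,q)$, depending only on $d$, on the eigenvalues $\lambda=(\lambda_1,\dots,\lambda_q)$ of $P$ and on $q$, such that for all $k\ge k_0$, $$E_k\ \ge\ 1-2q\,e^{-\frac{\delta^2q^2}{32}\lambda_2^2d}\qquad\text{and}\qquad \tilde E_k\ \ge\ 1-2q\,e^{-\frac{\delta^2q^2}{32}\lambda_2^2d}.$$
   Context: Fix $q\ge2$, a probability distribution $\pi$ on $[q]$ with all $\pi_i>0$, $D_\pi=\mathrm{diag}(\pi)$, $\delta>0$, $d>0$. $P$ is a $q\times q$ stochastic matrix reversible with respect to $\pi$ ($\pi_iP_{ij}=\pi_jP_{ji}$), with eigenvalues assumed to satisfy $1=\lambda_1\ge\lambda_2\ge\dots\ge\lambda_q\ge0$. $P=V^{-1}\Lambda V$ with $V=UD_\pi^{1/2}$, $U$ orthogonal with rows $u_\ell$; the eigenvector for $\lambda_\ell$ is $\xi_\ell(i)=\pi_i^{-1/2}u_\ell(i)$. The communities are $\delta$-distinguishable by a set of vectors $\{v_k\}$ if for all $i\ne j$ in $[q]$ there is $k$ with $|v_k(i)-v_k(j)|>\delta$. Broadcast process: $T$ is a Galton–Watson tree with Poisson($d$) offspring and root $\rho$; $\sigma_\rho\sim\pi$;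 each child of a vertex with label $i$ independently gets label $j$ with probability $P_{ij}$. $L_m(u)$ is the $m$-th level of the subtree rooted at $u$. Noisy labels: given $\sigma$, independently for each $u$, $\mathbb P(\tau_u=j\mid\sigma_u=i)=\Delta_{ij}$. The tree is observed, and $X_\rho^{(m)}(i)=\mathbb P(\sigma_\rho=i\mid\sigma_{L_m(\rho)})$, $\tilde X_\rho^{(m)}(i)=\mathbb P(\sigma_\rho=i\mid\tau_{L_m(\rho)})$. $E_m=\mathbb E[\max_iX_\rho^{(m)}(i)]$ and $\tilde E_m=\mathbb E[\max_i\tilde X_\rho^{(m)}(i)]$ are the optimal probabilities of guessing $\sigma_\rho$ from the (noisy) labels at level $m$.
   Formalization: For the noisy bound on Ẽ_k the threshold may also depend on the noise matrix Δ (not only on d, λ, q), since no threshold uniform over all invertible Δ exists: Ẽ_k tends to 1/2 for fixed k as Δ approaches a singular matrix; the bound on E_k keeps k_0(d,λ,q). *)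

theory Defs
  imports "HOL-Probability.Probability" "Jordan_Normal_Form.Matrix"
begin

section \<open>Transition matrices and their spectral data\<close>

text \<open>
  The label set $[q]$ is $\{0,\dots,q-1\}$, so the eigenvalues $\lambda_1,\lambda_2,\dots$
  are the list entries \<open>lam ! 0\<close>, \<open>lam ! 1\<close>, and so on.
\<close>

definition stochastic_mat :: "nat \<Rightarrow> real mat \<Rightarrow> bool" where
  "stochastic_mat q A \<longleftrightarrow> A \<in> carrier_mat q q \<and>
     (\<forall>i<q. (\<forall>j<q. 0 \<le> A $$ (i, j)) \<and> (\<Sum>j<q. A $$ (i, j)) = 1)"

definition reversible_mat :: "nat \<Rightarrow> nat pmf \<Rightarrow> real mat \<Rightarrow> bool" where
  "reversible_mat q \<pi> P \<longleftrightarrow>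
     (\<forall>i<q. \<forall>j<q. pmf \<pi> i * P $$ (i, j) = pmf \<pi> j * P $$ (j, i))"

text \<open>
  $P = V^{-1} \Lambda V$ with $V = U D_\pi^{1/2}$ and $U$ orthogonal; the witness \<open>W\<close> is
  $V^{-1}$.
\<close>

definition spectral_decomp ::
    "nat \<Rightarrow> nat pmf \<Rightarrow> real mat \<Rightarrow> real list \<Rightarrow> real mat \<Rightarrow> bool" where
  "spectral_decomp q \<pi> P lam U \<longleftrightarrow>
     length lam = q \<and> U \<in> carrier_mat q q \<and> U * transpose_mat U = 1\<^sub>m q \<and>
     (\<exists>W. similar_mat_wit P (mat_diag q (\<lambda>l. lam ! l)) W
            (U * mat_diag q (\<lambda>i. sqrt (pmf \<pi> i))))"

definition eigvec :: "nat pmf \<Rightarrow> real mat \<Rightarrow> nat \<Rightarrow> nat \<Rightarrow> real" where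
  "eigvec \<pi> U l i = U $$ (l, i) / sqrt (pmf \<pi> i)"

definition distinguishable :: "nat \<Rightarrow> real \<Rightarrow> (nat \<Rightarrow> real) set \<Rightarrow> bool" where
  "distinguishable q \<delta> vs \<longleftrightarrow>
     (\<forall>i<q. \<forall>j<q. i \<noteq> j \<longrightarrow> (\<exists>v\<in>vs. \<bar>v i - v j\<bar> > \<delta>))"

definition row_dist1 :: "nat \<Rightarrow> real mat \<Rightarrow> nat \<Rightarrow> nat \<Rightarrow> real" where
  "row_dist1 q P i j = (\<Sum>l<q. \<bar>P $$ (i, l) - P $$ (j, l)\<bar>)"

section \<open>The broadcast process\<close>

definition row_pmf :: "real mat \<Rightarrow> nat \<Rightarrow> nat pmf" where
  "row_pmf A i = embed_pmf (\<lambda>j. if j < dim_col A then A $$ (i, j) else 0)"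

lemma pmf_row_pmf:
  assumes "stochastic_mat q A" "i < q"
  shows "pmf (row_pmf A i) j = (if j < q then A $$ (i, j) else 0)"
proof -
  let ?f = "\<lambda>j. if j < q then A $$ (i, j) else 0"
  have nn: "\<And>j. 0 \<le> ?f j" and s: "(\<Sum>j<q. A $$ (i, j)) = 1" and d: "dim_col A = q"
    using assms by (auto simp: stochastic_mat_def)
  have "(\<integral>\<^sup>+ j. ennreal (?f j) \<partial>count_space UNIV) = (\<Sum>j<q. ennreal (?f j))"
    by (rule nn_integral_count_space') auto
  also have "\<dots> = ennreal (\<Sum>j<q. ?f j)"
    by (rule sum_ennreal) (use nn in blast)
  also have "\<dots> = 1" using s by simp
  finally have "(\<integral>\<^sup>+ j. ennreal (?f j) \<partial>count_space UNIV) = 1" .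
  then show ?thesis
    unfolding row_pmf_def d using nn by (subst pmf_embed_pmf) auto
qed

text \<open>Rooted plane trees whose vertices carry labels.\<close>

datatype 'a rtree = Node (root_label: 'a) (subtrees: "'a rtree list")

text \<open>
  \<open>broadcast d P m i\<close> is the law of the Galton--Watson tree with Poisson(d) offspring together
  with its labels $\sigma$, cut off below level \<open>m\<close>, given that the root has label \<open>i\<close>. The
  quantities $X^{(m)}_\rho$ and $\tilde X^{(m)}_\rho$ only involve the process up to level \<open>m\<close>:
  the tree below level \<open>m\<close> is independent of everything up to that level. By
  \<open>truncate_broadcast\<close> below, these laws are the successive truncations of one process.
\<close>

primrec broadcast :: "real \<Rightarrow> real mat \<Rightarrow> nat \<Rightarrow> nat \<Rightarrow> nat rtree pmf" where
  "broadcast d P 0 i = return_pmf (Node i [])"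
| "broadcast d P (Suc m) i =
     do { n \<leftarrow> poisson_pmf d;
          ts \<leftarrow> replicate_pmf n (do { j \<leftarrow> row_pmf P i; broadcast d P m j });
          return_pmf (Node i ts) }"

primrec truncate_tree :: "nat \<Rightarrow> 'a rtree \<Rightarrow> 'a rtree" where
  "truncate_tree 0 t = Node (root_label t) []"
| "truncate_tree (Suc m) t = Node (root_label t) (map (truncate_tree m) (subtrees t))"

lemma map_pmf_map_replicate_pmf:
  "map_pmf (map f) (replicate_pmf n p) = replicate_pmf n (map_pmf f p)"
proof (induction n)
  case (Suc n)
  then show ?case
    by (simp only: replicate_pmf.simps map_bind_pmf bind_map_pmf map_return_pmf list.map
              flip: Suc.IH)
qed simp

lemma truncate_broadcast:
  assumes "m \<le> n"
  shows "map_pmf (truncate_tree m) (broadcast d P n i) = broadcast d P m i"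
  using assms
proof (induction m arbitrary: n i)
  case 0
  show ?case
    by (cases n) (simp_all add: map_bind_pmf)
next
  case (Suc m)
  then obtain n' where n: "n = Suc n'" "m \<le> n'"
    by (cases n) auto
  let ?p = "row_pmf P i \<bind> broadcast d P n'"
  have *: "map_pmf (truncate_tree m) ?p = row_pmf P i \<bind> broadcast d P m"
    using Suc.IH[OF n(2)] by (simp add: map_bind_pmf)
  have "map_pmf (truncate_tree (Suc m)) (broadcast d P n i) =
          do { k \<leftarrow> poisson_pmf d;
               map_pmf (Node i) (map_pmf (map (truncate_tree m)) (replicate_pmf k ?p)) }"
    by (simp add: n(1) map_pmf_def bind_assoc_pmf bind_return_pmf)
  also have "\<dots> = broadcast d P (Suc m) i"
    unfolding map_pmf_map_replicate_pmf * by (simp add: map_pmf_def)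
  finally show ?case .
qed

primrec sequence_pmf :: "'a pmf list \<Rightarrow> 'a list pmf" where
  "sequence_pmf [] = return_pmf []"
| "sequence_pmf (p # ps) = do { x \<leftarrow> p; xs \<leftarrow> sequence_pmf ps; return_pmf (x # xs) }"

text \<open>
  The conditional law of the noisy labels $\tau$ given the tree and $\sigma$: independently at
  each vertex \<open>u\<close>, $\tau_u$ is drawn from row $\sigma_u$ of \<open>D\<close>.
\<close>

primrec noisy :: "real mat \<Rightarrow> nat rtree \<Rightarrow> nat rtree pmf" where
  "noisy D (Node i ts) =
     do { j \<leftarrow> row_pmf D i;
          ts' \<leftarrow> sequence_pmf (map (noisy D) ts);
          return_pmf (Node j ts') }"

text \<open>
  What is observed of a labelled tree of depth at most \<open>m\<close>: its shape, together with the labels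
  at level exactly \<open>m\<close>. Labels of all other vertices are erased, including those of childless
  vertices at levels less than \<open>m\<close>.
\<close>

primrec level_view :: "nat \<Rightarrow> 'a rtree \<Rightarrow> 'a option rtree" where
  "level_view 0 t = Node (Some (root_label t)) []"
| "level_view (Suc m) t = Node None (map (level_view m) (subtrees t))"

section \<open>Posteriors and optimal guessing probabilities\<close>

definition clean_law :: "nat pmf \<Rightarrow> real \<Rightarrow> real mat \<Rightarrow> nat \<Rightarrow> nat rtree pmf" where
  "clean_law \<pi> d P m = do { i \<leftarrow> \<pi>; broadcast d P m i }"

text \<open>Joint law of the process labelled by $\sigma$ and of its copy labelled by $\tau$.\<close>

definition noisy_law ::
    "nat pmf \<Rightarrow> real \<Rightarrow> real mat \<Rightarrow> real mat \<Rightarrow> nat \<Rightarrow> (nat rtree \<times> nat rtree) pmf" where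
  "noisy_law \<pi> d P D m =
     do { s \<leftarrow> clean_law \<pi> d P m; t \<leftarrow> noisy D s; return_pmf (s, t) }"

text \<open>
  The random vectors $X^{(m)}_\rho$ and $\tilde X^{(m)}_\rho$, as functions of the outcome. The
  observation is discrete, so the conditional probabilities are elementary ones.
\<close>

definition posterior ::
    "nat pmf \<Rightarrow> real \<Rightarrow> real mat \<Rightarrow> nat \<Rightarrow> nat rtree \<Rightarrow> nat \<Rightarrow> real" where
  "posterior \<pi> d P m \<omega> i =
     \<P>(x in measure_pmf (clean_law \<pi> d P m).
         root_label x = i \<bar> level_view m x = level_view m \<omega>)"

definition noisy_posterior ::
    "nat pmf \<Rightarrow> real \<Rightarrow> real mat \<Rightarrow> real mat \<Rightarrow> nat \<Rightarrow> nat rtree \<times> nat rtree \<Rightarrow> nat \<Rightarrow> real"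
where
  "noisy_posterior \<pi> d P D m \<omega> i =
     \<P>(x in measure_pmf (noisy_law \<pi> d P D m).
         root_label (fst x) = i \<bar> level_view m (snd x) = level_view m (snd \<omega>))"

definition E_opt :: "nat \<Rightarrow> nat pmf \<Rightarrow> real \<Rightarrow> real mat \<Rightarrow> nat \<Rightarrow> real" where
  "E_opt q \<pi> d P m =
     measure_pmf.expectation (clean_law \<pi> d P m) (\<lambda>\<omega>. MAX i\<in>{..<q}. posterior \<pi> d P m \<omega> i)"

definition E_noisy :: "nat \<Rightarrow> nat pmf \<Rightarrow> real \<Rightarrow> real mat \<Rightarrow> real mat \<Rightarrow> nat \<Rightarrow> real" where
  "E_noisy q \<pi> d P D m =
     measure_pmf.expectation (noisy_law \<pi> d P D m)
       (\<lambda>\<omega>. MAX i\<in>{..<q}. noisy_posterior \<pi> d P D m \<omega> i)"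

end

theory Submission
  imports Defs
begin

text \<open>
  For an eigenvector $\xi$ with eigenvalue $\lambda$ and $\lambda^2 d$ large, the normalised sum
  of $\xi$ over level $m$ has conditional mean $\xi(\sigma_\rho)$ and variance
  $O(1/(\lambda^2 d))$, so by Chebyshev and distinguishability the root label is guessed correctly
  with conditional probability at least $3/4$, whatever it is. With noise, $\xi$ at the leaves is
  replaced by $\Delta^{-1}\xi$, whose additional variance decays geometrically in $m$.

  This is boosted by one generation. Let $Q_i$ be the law of the view below a random child of a root
  with label $i$. Guessing the child's label shows that $Q_i$ and $Q_j$ differ by at least
  $\|P_i - P_j\|_1/4$ on some event, so their Bhattacharyya coefficient $b$ satisfies
  $1 - b \ge \|P_i - P_j\|_1^2/32$. The Poisson number of independent children turns $b$
  into $e^{-d(1-b)}$, and the Bayes error is at most the sum of $\sqrt{\pi_i\pi_j}$ times these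
  coefficients over the pairs $i \ne j$.
\<close>

section \<open>Bhattacharyya coefficients\<close>

text \<open>The Hellinger affinity. Values in \<open>ennreal\<close> let sums be split and
  interchanged without summability conditions.\<close>

definition bhatt :: "'a pmf \<Rightarrow> 'a pmf \<Rightarrow> ennreal" where
  "bhatt p q = (\<integral>\<^sup>+x. ennreal (sqrt (pmf p x * pmf q x)) \<partial>count_space UNIV)"

text \<open>
  With \<open>c\<close> the inner product of the unit vectors $(\sqrt a, \sqrt{1-a})$ and
  $(\sqrt b, \sqrt{1-b})$, one has $(a - b)^2 \le 1 - c^2 \le 2 (1 - c)$.
\<close>

lemma sqrt_mult_add_sqrt_mult_le:
  fixes a b :: real
  assumes "0 \<le> a" "a \<le> 1" "0 \<le> b" "b \<le> 1"
  shows "sqrt (a * b) + sqrt ((1 - a) * (1 - b)) \<le> 1 - (a - b)\<^sup>2 / 2"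
proof -
  define x y x' y' where "x = sqrt a" "y = sqrt b" "x' = sqrt (1 - a)" "y' = sqrt (1 - b)"
  note d = this
  define c where "c = x * y + x' * y'"
  have s: "x\<^sup>2 = a" "y\<^sup>2 = b" "x'\<^sup>2 = 1 - a" "y'\<^sup>2 = 1 - b" and nn: "x \<ge> 0" "y \<ge> 0" "x' \<ge> 0" "y' \<ge> 0"
    using assms by (auto simp: d)
  have "(x * y' - y * x')\<^sup>2 = x\<^sup>2 * y'\<^sup>2 + y\<^sup>2 * x'\<^sup>2 - 2 * (x * y * (x' * y'))"
    by (simp add: power2_eq_square algebra_simps)
  moreover have "c\<^sup>2 = x\<^sup>2 * y\<^sup>2 + x'\<^sup>2 * y'\<^sup>2 + 2 * (x * y * (x' * y'))"
    unfolding c_def by (simp add: power2_eq_square algebra_simps)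
  ultimately have 1: "(x * y' - y * x')\<^sup>2 = 1 - c\<^sup>2"
    unfolding s by (simp add: algebra_simps)
  have "0 \<le> (x * y - x' * y')\<^sup>2" by simp
  moreover have "(x * y - x' * y')\<^sup>2 = x\<^sup>2 * y\<^sup>2 + x'\<^sup>2 * y'\<^sup>2 - 2 * (x * y * (x' * y'))"
    by (simp add: power2_eq_square algebra_simps)
  moreover have "(x * y' + y * x')\<^sup>2 = x\<^sup>2 * y'\<^sup>2 + y\<^sup>2 * x'\<^sup>2 + 2 * (x * y * (x' * y'))"
    by (simp add: power2_eq_square algebra_simps)
  ultimately have 2: "(x * y' + y * x')\<^sup>2 \<le> 1"
    unfolding s by (simp add: algebra_simps)
  have "(x * y' - y * x') * (x * y' + y * x') = x\<^sup>2 * y'\<^sup>2 - y\<^sup>2 * x'\<^sup>2"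
    by (simp add: power2_eq_square algebra_simps)
  also have "\<dots> = a - b" unfolding s by (simp add: algebra_simps)
  finally have "(a - b)\<^sup>2 = (x * y' - y * x')\<^sup>2 * (x * y' + y * x')\<^sup>2"
    by (metis power_mult_distrib)
  also have "\<dots> \<le> (x * y' - y * x')\<^sup>2" using 2 by (simp add: mult_left_le)
  also have "\<dots> = 1 - c\<^sup>2" by (rule 1)
  also have "\<dots> \<le> 2 * (1 - c)"
  proof -
    have "0 \<le> (1 - c)\<^sup>2" by simp
    then show ?thesis by (simp add: power2_eq_square algebra_simps)
  qed
  finally show ?thesis using assms by (simp add: c_def d real_sqrt_mult)
qed

text \<open>Cauchy-Schwarz for the square roots of the two mass functions, both restricted to
  \<open>A\<close>.\<close>

lemma nn_integral_sqrt_pmf_le: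
  "(\<integral>\<^sup>+x. ennreal (sqrt (pmf p x * pmf q x)) * indicator A x \<partial>count_space UNIV)
     \<le> ennreal (sqrt (measure p A * measure q A))" (is "?I \<le> _")
proof -
  let ?f = "\<lambda>p x. ennreal (sqrt (pmf p x)) * indicator A x"
  have sq: "(\<integral>\<^sup>+x. (?f p x)\<^sup>2 \<partial>count_space UNIV) = ennreal (measure p A)" for p :: "'a pmf"
  proof -
    have "(\<integral>\<^sup>+x. (?f p x)\<^sup>2 \<partial>count_space UNIV) = (\<integral>\<^sup>+x. ennreal (pmf p x) * indicator A x \<partial>count_space UNIV)"
      by (intro nn_integral_cong) (auto simp: indicator_def ennreal_power)
    also have "\<dots> = (\<integral>\<^sup>+x. ennreal (pmf p x) \<partial>count_space A)"
      by (simp add: nn_integral_count_space_indicator)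
    finally show ?thesis by (simp add: nn_integral_pmf measure_pmf.emeasure_eq_measure)
  qed
  have "?I = (\<integral>\<^sup>+x. ?f p x * ?f q x \<partial>count_space UNIV)"
    by (intro nn_integral_cong) (auto simp: indicator_def real_sqrt_mult ennreal_mult)
  then have "?I\<^sup>2 \<le> ennreal (measure p A) * ennreal (measure q A)"
    using Cauchy_Schwarz_nn_integral[of "?f p" "count_space UNIV" "?f q"] by (simp add: sq)
  also have "\<dots> = (ennreal (sqrt (measure p A * measure q A)))\<^sup>2"
    by (simp add: ennreal_power ennreal_mult)
  finally have le: "?I\<^sup>2 \<le> (ennreal (sqrt (measure p A * measure q A)))\<^sup>2" .
  \<comment> \<open>Squares are cancelled for a finite integral; an infinite one would contradict
    the finite bound.\<close>
  then show ?thesis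
  proof (cases ?I)
    case (real r)
    with le show ?thesis
      by (simp add: ennreal_power) (metis measure_nonneg mult_nonneg_nonneg power2_le_imp_le
          real_sqrt_ge_zero real_sqrt_pow2 ennreal_leI)
  qed (simp add: ennreal_power top_power_ennreal top_unique)
qed

text \<open>Merging all outcomes into \<open>A\<close> and its complement can only increase the
  affinity. This leaves two distributions on two points, covered by
  \<open>sqrt_mult_add_sqrt_mult_le\<close>.\<close>

lemma bhatt_le:
  "bhatt p q \<le> ennreal (1 - (measure p A - measure q A)\<^sup>2 / 2)"
proof -
  let ?g = "\<lambda>x. ennreal (sqrt (pmf p x * pmf q x))"
  have "bhatt p q = (\<integral>\<^sup>+x. ?g x * indicator A x + ?g x * indicator (- A) x \<partial>count_space UNIV)"
    unfolding bhatt_def by (intro nn_integral_cong) (auto simp: indicator_def)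
  also have "\<dots> = (\<integral>\<^sup>+x. ?g x * indicator A x \<partial>count_space UNIV) + (\<integral>\<^sup>+x. ?g x * indicator (-A) x \<partial>count_space UNIV)"
    by (intro nn_integral_add) auto
  also have "\<dots> \<le> ennreal (sqrt (measure p A * measure q A)) + ennreal (sqrt (measure p (-A) * measure q (-A)))"
    by (intro add_mono nn_integral_sqrt_pmf_le)
  also have "\<dots> = ennreal (sqrt (measure p A * measure q A) + sqrt ((1 - measure p A) * (1 - measure q A)))"
    using measure_pmf.prob_compl[of A] by (simp add: Compl_eq_Diff_UNIV flip: ennreal_plus)
  also have "\<dots> \<le> ennreal (1 - (measure p A - measure q A)\<^sup>2 / 2)"
    by (intro ennreal_leI sqrt_mult_add_sqrt_mult_le) auto
  finally show ?thesis .
qed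

text \<open>Outcomes outside the range of \<open>f\<close> carry no mass. This later strips the
  constructor \<open>Node None\<close> from a view.\<close>

lemma bhatt_map_inj:
  assumes "inj f"
  shows "bhatt (map_pmf f p) (map_pmf f q) = bhatt p q"
proof -
  let ?g = "\<lambda>y. ennreal (sqrt (pmf (map_pmf f p) y * pmf (map_pmf f q) y))"
  have "bhatt p q = (\<integral>\<^sup>+x. ?g (f x) \<partial>count_space UNIV)"
    unfolding bhatt_def by (simp add: pmf_map_inj'[OF assms])
  also have "\<dots> = (\<integral>\<^sup>+y. ?g y \<partial>count_space (range f))"
    using assms by (intro nn_integral_bij_count_space) (simp add: bij_betw_def)
  also have "\<dots> = (\<integral>\<^sup>+y. ?g y \<partial>count_space UNIV)"
    by (rule nn_integral_count_space_eq) (auto simp: pmf_eq_0_set_pmf)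
  finally show ?thesis by (simp add: bhatt_def)
qed

section \<open>Lists of independent samples of fixed and of Poisson length\<close>

lemma pmf_replicate_pmf:
  "pmf (replicate_pmf n p) xs = (if length xs = n then prod_list (map (pmf p) xs) else 0)"
proof (cases "length xs = n")
  case False
  then have "xs \<notin> set_pmf (replicate_pmf n p)" by (auto simp: set_replicate_pmf)
  then show ?thesis using False by (simp add: pmf_eq_0_set_pmf)
next
  case True
  then show ?thesis
  proof (induction n arbitrary: xs)
    case (Suc n)
    then obtain y ys where xs: "xs = y # ys" "length ys = n" by (cases xs) auto
    have "replicate_pmf (Suc n) p = map_pmf (\<lambda>(x, xs). x # xs) (pair_pmf p (replicate_pmf n p))"
      by (simp add: pair_pmf_def map_bind_pmf)
    moreover have "inj (\<lambda>(x :: 'a, xs). x # xs)" by (auto simp: inj_on_def)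
    from pmf_map_inj'[OF this, of _ "(y, ys)"]
    have "pmf (map_pmf (\<lambda>(x, xs). x # xs) (pair_pmf p (replicate_pmf n p))) (y # ys)
        = pmf p y * pmf (replicate_pmf n p) ys" by (simp add: pmf_pair)
    ultimately show ?case using Suc.IH[OF xs(2)] xs by simp
  qed simp
qed

text \<open>Tonelli, peeling off the head of the list. This makes the affinity multiplicative over
  independent samples.\<close>

lemma nn_integral_prod_list:
  fixes g :: "'a \<Rightarrow> ennreal"
  shows "(\<integral>\<^sup>+xs. prod_list (map g xs) \<partial>count_space {xs. length xs = n})
           = (\<integral>\<^sup>+x. g x \<partial>count_space UNIV) ^ n"
proof (induction n)
  case 0
  have "{xs :: 'a list. length xs = 0} = {[]}" by auto
  then show ?case by (simp add: nn_integral_count_space_finite)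
next
  case (Suc n)
  let ?L = "{xs :: 'a list. length xs = n}"
  have bij: "bij_betw (\<lambda>(x, xs). x # xs) (UNIV \<times> ?L) {xs :: 'a list. length xs = Suc n}"
    by (auto simp: bij_betw_def inj_on_def length_Suc_conv)
  have "(\<integral>\<^sup>+xs. prod_list (map g xs) \<partial>count_space {xs. length xs = Suc n})
      = (\<integral>\<^sup>+z. prod_list (map g ((\<lambda>(x, xs). x # xs) z)) \<partial>count_space (UNIV \<times> ?L))"
    by (rule nn_integral_bij_count_space[OF bij, symmetric])
  also have "\<dots> = (\<integral>\<^sup>+z. g (fst z) * prod_list (map g (snd z)) * indicator ?L (snd z) \<partial>count_space UNIV)"
    by (auto simp: nn_integral_count_space_indicator indicator_def intro!: nn_integral_cong)
  also have "\<dots> = (\<integral>\<^sup>+x. \<integral>\<^sup>+xs. g x * prod_list (map g xs) * indicator ?L xs \<partial>count_space UNIV \<partial>count_space UNIV)"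
    by (subst nn_integral_fst_count_space[symmetric]) simp
  also have "\<dots> = (\<integral>\<^sup>+x. g x * (\<integral>\<^sup>+xs. prod_list (map g xs) \<partial>count_space ?L) \<partial>count_space UNIV)"
    by (simp add: nn_integral_cmult mult.assoc flip: nn_integral_count_space_indicator)
  also have "\<dots> = (\<integral>\<^sup>+x. g x \<partial>count_space UNIV) ^ Suc n"
    by (simp add: Suc nn_integral_multc)
  finally show ?case .
qed

text \<open>Given the label of a vertex, the subtrees at its children form such a list. Both the
  affinity and the moment recursions pass through this law.\<close>

definition poisson_list :: "real \<Rightarrow> 'a pmf \<Rightarrow> 'a list pmf" where
  "poisson_list d p = poisson_pmf d \<bind> (\<lambda>n. replicate_pmf n p)"

lemma pmf_poisson_list:
  assumes "d > 0"
  shows "pmf (poisson_list d p) xs = pmf (poisson_pmf d) (length xs) * prod_list (map (pmf p) xs)"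
proof -
  have "pmf (poisson_list d p) xs
      = (\<integral>n. indicator {length xs} n * prod_list (map (pmf p) xs) \<partial>measure_pmf (poisson_pmf d))"
    unfolding poisson_list_def pmf_bind
    by (intro Bochner_Integration.integral_cong) (auto simp: pmf_replicate_pmf)
  then show ?thesis by (simp add: measure_pmf_single)
qed

lemma prod_list_map_sqrt:
  "prod_list (map (\<lambda>x. ennreal (sqrt (f x * g x))) xs)
     = ennreal (sqrt (prod_list (map f xs) * prod_list (map g xs)))"
  if "\<And>x. f x \<ge> 0" "\<And>x. g x \<ge> 0"
proof (induction xs)
  case (Cons a xs)
  have "prod_list (map f xs) \<ge> 0" "prod_list (map g xs) \<ge> 0"
    using that by (auto intro!: prod_list_nonneg)
  with Cons show ?case
    by (simp add: that real_sqrt_mult mult_ac flip: ennreal_mult)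
qed simp

text \<open>Both laws have the same length distribution, and lists of length \<open>n\<close>
  contribute \<open>b ^ n\<close>. Averaging over the Poisson length evaluates its generating
  function at \<open>b\<close>.\<close>

lemma bhatt_poisson_list:
  assumes d: "d > 0" and b: "bhatt p q = ennreal b" "b \<ge> 0"
  shows "bhatt (poisson_list d p) (poisson_list d q) = ennreal (exp (- (d * (1 - b))))"
proof -
  let ?g = "\<lambda>x. ennreal (sqrt (pmf p x * pmf q x))"
  let ?\<pi> = "\<lambda>n. ennreal (pmf (poisson_pmf d) n)"
  let ?F = "\<lambda>n xs. ?\<pi> n * prod_list (map ?g xs) * indicator {xs. length xs = n} xs"
  have "bhatt (poisson_list d p) (poisson_list d q)
      = (\<integral>\<^sup>+xs. ?\<pi> (length xs) * prod_list (map ?g xs) \<partial>count_space UNIV)"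
    unfolding bhatt_def
  proof (intro nn_integral_cong)
    fix xs
    have "prod_list (map (pmf p) xs) \<ge> 0" "prod_list (map (pmf q) xs) \<ge> 0"
      by (auto intro!: prod_list_nonneg)
    then show "ennreal (sqrt (pmf (poisson_list d p) xs * pmf (poisson_list d q) xs))
        = ?\<pi> (length xs) * prod_list (map ?g xs)"
      using d unfolding prod_list_map_sqrt[of "pmf p" "pmf q", OF pmf_nonneg pmf_nonneg]
      by (simp add: pmf_poisson_list real_sqrt_mult real_sqrt_divide mult_ac flip: ennreal_mult)
  qed
  \<comment> \<open>An indicator sorts the lists by length, so that Tonelli can move the sum over
    lengths outside.\<close>
  also have "\<dots> = (\<integral>\<^sup>+xs. \<integral>\<^sup>+n. ?F n xs \<partial>count_space UNIV \<partial>count_space UNIV)"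
  proof (intro nn_integral_cong)
    fix xs :: "'a list"
    have "(\<integral>\<^sup>+n. ?F n xs \<partial>count_space UNIV) = (\<Sum>n | n = length xs. ?F n xs)"
      by (rule nn_integral_count_space') auto
    then show "?\<pi> (length xs) * prod_list (map ?g xs) = (\<integral>\<^sup>+n. ?F n xs \<partial>count_space UNIV)" by simp
  qed
  also have "\<dots> = (\<integral>\<^sup>+n. \<integral>\<^sup>+xs. ?F n xs \<partial>count_space UNIV \<partial>count_space UNIV)"
    by (simp add: nn_integral_fst_count_space[where f = "\<lambda>z. ?F (snd z) (fst z)", simplified]
      nn_integral_snd_count_space[where f = "\<lambda>z. ?F (snd z) (fst z)", simplified])
  also have "\<dots> = (\<integral>\<^sup>+n. ?\<pi> n * bhatt p q ^ n \<partial>count_space UNIV)"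
    by (simp add: mult.assoc nn_integral_cmult nn_integral_prod_list bhatt_def
        flip: nn_integral_count_space_indicator)
  also have "\<dots> = (\<Sum>n. ennreal (exp (- d) * ((d * b) ^ n /\<^sub>R fact n)))"
    unfolding nn_integral_count_space_nat using d b(2) unfolding b(1)
    by (intro suminf_cong) (simp add: power_mult_distrib field_simps ennreal_power flip: ennreal_mult)
  also have "\<dots> = ennreal (exp (- d) * exp (d * b))"
    using d b(2) by (intro suminf_ennreal_eq sums_mult exp_converges) auto
  finally show ?thesis by (simp add: algebra_simps flip: exp_add)
qed

section \<open>Bayes error from pairwise affinities\<close>

lemma one_minus_Max_le_sum_sqrt:
  fixes a :: "nat \<Rightarrow> real"
  assumes a: "\<And>i. i < q \<Longrightarrow> 0 \<le> a i" and s: "s = (\<Sum>i<q. a i)" "s > 0"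
  shows "1 - (MAX i\<in>{..<q}. a i / s) \<le> (\<Sum>i<q. \<Sum>j\<in>{..<q} - {i}. sqrt (a i * a j)) / s"
proof -
  have "q > 0" using s by (cases q) auto
  let ?m = "MAX i\<in>{..<q}. a i / s"
  have "?m \<in> (\<lambda>i. a i / s) ` {..<q}" using \<open>q > 0\<close> by (intro Max_in) auto
  then obtain k where k: "k < q" "?m = a k / s" by auto
  have le: "a j \<le> a k" if "j < q" for j
  proof -
    have "a j / s \<le> ?m" using that by (intro Max_ge) auto
    then show ?thesis using k s(2) by (simp add: divide_le_cancel)
  qed
  have "s - a k = (\<Sum>j\<in>{..<q} - {k}. a j)"
    using k s(1) by (simp add: sum_diff1)
  \<comment> \<open>Since \<open>k\<close> maximises \<open>a\<close>, every other
    \<open>a j\<close> is at most the geometric mean of \<open>a k\<close> and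
    \<open>a j\<close>.\<close>
  also have "\<dots> \<le> (\<Sum>j\<in>{..<q} - {k}. sqrt (a k * a j))"
  proof (intro sum_mono real_le_rsqrt)
    fix j assume "j \<in> {..<q} - {k}"
    then show "(a j)\<^sup>2 \<le> a k * a j"
      using a le by (auto simp: power2_eq_square intro!: mult_right_mono)
  qed
  also have "\<dots> \<le> (\<Sum>i<q. \<Sum>j\<in>{..<q} - {i}. sqrt (a i * a j))"
    using k a by (intro member_le_sum sum_nonneg) auto
  finally have "(s - a k) / s \<le> (\<Sum>i<q. \<Sum>j\<in>{..<q} - {i}. sqrt (a i * a j)) / s"
    using s(2) by (intro divide_right_mono) auto
  then show ?thesis using s(2) k by (simp add: diff_divide_distrib)
qed

lemma pmf_bind_map_Pair:
  "pmf (\<pi> \<bind> (\<lambda>i. map_pmf (Pair i) (\<kappa> i))) (i, v) = pmf \<pi> i * pmf (\<kappa> i) v"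
proof -
  have "pmf (map_pmf (Pair j) (\<kappa> j)) (i, v) = indicator {i} j * pmf (\<kappa> i) v" for j
  proof (cases "j = i")
    case True
    then show ?thesis using pmf_map_inj'[of "Pair i" "\<kappa> i" v] by (simp add: inj_on_def)
  next
    case False
    then have "(i, v) \<notin> set_pmf (map_pmf (Pair j) (\<kappa> j))" by auto
    then show ?thesis using False by (simp add: pmf_eq_0_set_pmf)
  qed
  then show ?thesis by (simp add: pmf_bind measure_pmf_single)
qed

text \<open>Only the joint law of label and observation enters, so the clean and the noisy
  experiment are both instances. Weighting the pointwise error bound by the probability
  \<open>s v\<close> of the observation cancels its denominator, and summing over \<open>v\<close>
  produces the affinities.\<close>

lemma bayes_optimal_ge:
  fixes J :: "'a pmf" and r :: "'a \<Rightarrow> nat" and obs :: "'a \<Rightarrow> 'b"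
  assumes J: "map_pmf (\<lambda>x. (r x, obs x)) J = \<pi> \<bind> (\<lambda>i. map_pmf (Pair i) (\<kappa> i))"
    and \<pi>: "set_pmf \<pi> = {..<q}" "q > 0"
    and bh: "\<And>i j. i < q \<Longrightarrow> j < q \<Longrightarrow> i \<noteq> j \<Longrightarrow> bhatt (\<kappa> i) (\<kappa> j) \<le> ennreal \<beta>"
    and \<beta>: "\<beta> \<ge> 0"
  shows "1 - real q * \<beta> \<le> measure_pmf.expectation J
     (\<lambda>\<omega>. MAX i\<in>{..<q}. \<P>(x in measure_pmf J. r x = i \<bar> obs x = obs \<omega>))"
proof -
  define a where "a i v = pmf \<pi> i * pmf (\<kappa> i) v" for i v
  define s where "s v = (\<Sum>i<q. a i v)" for v
  define h where "h v = (MAX i\<in>{..<q}. a i v / s v)" for v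
  define c where "c v = (\<Sum>i<q. \<Sum>j\<in>{..<q} - {i}. sqrt (a i v * a j v))" for v
  define M where "M = map_pmf obs J"
  have a0: "a i v \<ge> 0" for i v by (simp add: a_def)
  have c0: "c v \<ge> 0" for v unfolding c_def using a0 by (intro sum_nonneg) auto
  have joint: "measure_pmf.prob J {x. r x = i \<and> obs x = v} = a i v" for i v
  proof -
    have "a i v = pmf (map_pmf (\<lambda>x. (r x, obs x)) J) (i, v)"
      by (simp add: J pmf_bind_map_Pair a_def)
    also have "\<dots> = measure_pmf.prob J ((\<lambda>x. (r x, obs x)) -` {(i, v)})" by (rule pmf_map)
    also have "(\<lambda>x. (r x, obs x)) -` {(i, v)} = {x. r x = i \<and> obs x = v}" by auto
    finally show ?thesis by simp
  qed
  have "M = map_pmf snd (map_pmf (\<lambda>x. (r x, obs x)) J)"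
    by (simp add: M_def pmf.map_comp o_def)
  also have "\<dots> = \<pi> \<bind> \<kappa>" by (simp add: J map_bind_pmf pmf.map_comp o_def)
  finally have M: "M = \<pi> \<bind> \<kappa>" .
  have pmf_M: "pmf M v = s v" for v
    unfolding M pmf_bind s_def a_def
    using \<pi>(1) by (subst integral_measure_pmf_real[where A = "{..<q}"]) (auto simp: mult.commute)
  have marg: "measure_pmf.prob J {x. obs x = v} = s v" for v
    using pmf_M[of v] by (simp add: M_def pmf_map vimage_def)
  have "measure_pmf.expectation J (\<lambda>\<omega>. MAX i\<in>{..<q}. \<P>(x in measure_pmf J. r x = i \<bar> obs x = obs \<omega>))
      = measure_pmf.expectation M h"
    by (simp add: M_def h_def cond_prob_def joint marg)
  moreover have "1 - measure_pmf.expectation M h \<le> real q * \<beta>"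
  proof -
    have spos: "s v > 0" if "v \<in> set_pmf M" for v
      using that pmf_M by (simp add: pmf_positive flip: pmf_M)
    have h01: "0 \<le> h v \<and> h v \<le> 1" if "v \<in> set_pmf M" for v
    proof -
      have "h v \<in> (\<lambda>i. a i v / s v) ` {..<q}" unfolding h_def using \<pi>(2) by (intro Max_in) auto
      then obtain k where k: "k < q" "h v = a k v / s v" by auto
      moreover have "a k v \<le> s v" unfolding s_def using k a0 by (intro member_le_sum) auto
      ultimately show ?thesis using spos[OF that] a0 by simp
    qed
    have int: "integrable (measure_pmf M) h"
      by (rule measure_pmf.integrable_const_bound[where B = 1]) (auto simp: AE_measure_pmf_iff h01)
    have "ennreal (1 - measure_pmf.expectation M h) = ennreal (measure_pmf.expectation M (\<lambda>v. 1 - h v))"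
      using int by simp
    also have "\<dots> = (\<integral>\<^sup>+v. ennreal (1 - h v) \<partial>measure_pmf M)"
      using int by (intro nn_integral_eq_integral[symmetric]) (auto simp: AE_measure_pmf_iff h01)
    also have "\<dots> \<le> (\<integral>\<^sup>+v. ennreal (c v / s v) \<partial>measure_pmf M)"
    proof (intro nn_integral_mono_AE, unfold AE_measure_pmf_iff, intro ballI ennreal_leI)
      fix v assume "v \<in> set_pmf M"
      then show "1 - h v \<le> c v / s v"
        unfolding h_def c_def by (intro one_minus_Max_le_sum_sqrt a0 s_def spos)
    qed
    also have "\<dots> = (\<integral>\<^sup>+v. ennreal (s v) * ennreal (c v / s v) \<partial>count_space UNIV)"
      by (simp add: nn_integral_measure_pmf pmf_M)
    also have "\<dots> \<le> (\<integral>\<^sup>+v. ennreal (c v) \<partial>count_space UNIV)"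
    proof (intro nn_integral_mono)
      fix v
      \<comment> \<open>Where \<open>s v = 0\<close> the left side vanishes, and the bound is just
        nonnegativity of \<open>c v\<close>.\<close>
      have "s v \<ge> 0" unfolding s_def by (intro sum_nonneg a0)
      then show "ennreal (s v) * ennreal (c v / s v) \<le> ennreal (c v)"
        using c0[of v] by (cases "s v = 0") (auto simp flip: ennreal_mult)
    qed
    also have "\<dots> = (\<integral>\<^sup>+v. (\<Sum>i<q. \<Sum>j\<in>{..<q} - {i}. ennreal (sqrt (pmf \<pi> i * pmf \<pi> j)) *
        ennreal (sqrt (pmf (\<kappa> i) v * pmf (\<kappa> j) v))) \<partial>count_space UNIV)"
      unfolding c_def using a0
      by (intro nn_integral_cong)
        (auto simp: a_def sum_nonneg real_sqrt_mult mult_ac simp flip: ennreal_mult sum_ennreal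
          intro!: sum.cong)
    also have "\<dots> = (\<Sum>i<q. \<Sum>j\<in>{..<q} - {i}. ennreal (sqrt (pmf \<pi> i * pmf \<pi> j)) * bhatt (\<kappa> i) (\<kappa> j))"
      by (simp add: nn_integral_sum nn_integral_cmult bhatt_def)
    \<comment> \<open>The geometric mean of the priors is replaced by the arithmetic one. Once the
      diagonal is added, these weights sum to \<open>q\<close>, the factor in the
      conclusion.\<close>
    also have "\<dots> \<le> (\<Sum>i<q. \<Sum>j\<in>{..<q} - {i}. ennreal ((pmf \<pi> i + pmf \<pi> j) / 2) * ennreal \<beta>)"
      by (intro sum_mono mult_mono ennreal_leI arith_geo_mean_sqrt bh) auto
    also have "\<dots> = ennreal (\<Sum>i<q. \<Sum>j\<in>{..<q} - {i}. (pmf \<pi> i + pmf \<pi> j) / 2 * \<beta>)"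
      using \<beta> by (simp add: sum_nonneg flip: ennreal_mult sum_ennreal)
    also have "\<dots> \<le> ennreal (\<Sum>i<q. \<Sum>j<q. (pmf \<pi> i + pmf \<pi> j) / 2 * \<beta>)"
      using \<beta> by (intro ennreal_leI sum_mono sum_mono2) auto
    also have "(\<Sum>i<q. \<Sum>j<q. (pmf \<pi> i + pmf \<pi> j) / 2 * \<beta>) = real q * \<beta>"
    proof -
      have "(\<Sum>i<q. pmf \<pi> i) = 1" using \<pi> by (intro sum_pmf_eq_1) auto
      then show ?thesis
        by (simp add: sum.distrib add_divide_distrib flip: sum_distrib_left sum_distrib_right sum_divide_distrib)
    qed
    finally show ?thesis using \<beta> by (subst (asm) ennreal_le_iff) auto
  qed
  ultimately show ?thesis by simp
qed

section \<open>Means and variances\<close>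

text \<open>
  A random variable \<open>f\<close> with mean \<open>\<mu>\<close> and variance \<open>v\<close>. Testing the nonnegative functions
  $(a + f)^2$ for all \<open>a\<close> encodes both moments without any integrability side conditions.
\<close>

definition quad_moments :: "'a pmf \<Rightarrow> ('a \<Rightarrow> real) \<Rightarrow> real \<Rightarrow> real \<Rightarrow> bool" where
  "quad_moments p f \<mu> v \<longleftrightarrow>
     v \<ge> 0 \<and> (\<forall>a. (\<integral>\<^sup>+x. ennreal ((a + f x)\<^sup>2) \<partial>measure_pmf p) = ennreal ((a + \<mu>)\<^sup>2 + v))"

lemma quad_moments_return: "quad_moments (return_pmf x) f (f x) 0"
  by (simp add: quad_moments_def)

lemma quad_moments_map: "quad_moments (map_pmf g p) f \<mu> v \<longleftrightarrow> quad_moments p (\<lambda>x. f (g x)) \<mu> v"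
  by (simp add: quad_moments_def)

text \<open>The law of total variance. The variance is left as second moment minus squared mean
  because the Poisson sum formula adds the squared mean back.\<close>

lemma quad_moments_bind:
  assumes A: "finite A" "set_pmf w \<subseteq> A"
    and g: "\<And>j. j \<in> A \<Longrightarrow> quad_moments (g j) f (\<mu> j) (v j)"
  shows "quad_moments (w \<bind> g) f (\<Sum>j\<in>A. pmf w j * \<mu> j)
           ((\<Sum>j\<in>A. pmf w j * ((\<mu> j)\<^sup>2 + v j)) - (\<Sum>j\<in>A. pmf w j * \<mu> j)\<^sup>2)"
    (is "quad_moments _ _ ?\<mu> ?v")
  unfolding quad_moments_def
proof (intro conjI allI)
  have w1: "(\<Sum>j\<in>A. pmf w j) = 1" using A by (rule sum_pmf_eq_1)
  have v: "v j \<ge> 0" if "j \<in> A" for j using g[OF that] by (simp add: quad_moments_def)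
  \<comment> \<open>The proposed variance is the mean of the conditional variances plus the squared
    deviations of the conditional means.\<close>
  have "0 \<le> (\<Sum>j\<in>A. pmf w j * ((\<mu> j - ?\<mu>)\<^sup>2 + v j))" using v by (intro sum_nonneg) auto
  also have "\<dots> = (\<Sum>j\<in>A. pmf w j * ((\<mu> j)\<^sup>2 + v j) - 2 * ?\<mu> * (pmf w j * \<mu> j) + ?\<mu>\<^sup>2 * pmf w j)"
    by (intro sum.cong) (auto simp: power2_eq_square algebra_simps)
  also have "\<dots> = (\<Sum>j\<in>A. pmf w j * ((\<mu> j)\<^sup>2 + v j)) - 2 * ?\<mu> * ?\<mu> + ?\<mu>\<^sup>2 * (\<Sum>j\<in>A. pmf w j)"
    by (simp add: sum.distrib sum_subtractf sum_distrib_left)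
  also have "\<dots> = ?v" by (simp add: w1 power2_eq_square)
  finally show "0 \<le> ?v" .
  fix a
  have "(\<integral>\<^sup>+x. ennreal ((a + f x)\<^sup>2) \<partial>measure_pmf (w \<bind> g))
      = (\<Sum>j\<in>A. (\<integral>\<^sup>+x. ennreal ((a + f x)\<^sup>2) \<partial>measure_pmf (g j)) * ennreal (pmf w j))"
    using A by (simp only: nn_integral_bind_pmf) (rule nn_integral_measure_pmf_support; auto)
  also have "\<dots> = (\<Sum>j\<in>A. ennreal (pmf w j * ((a + \<mu> j)\<^sup>2 + v j)))"
    using g v by (intro sum.cong) (auto simp: quad_moments_def mult.commute ennreal_mult simp del: ennreal_plus)
  also have "\<dots> = ennreal (\<Sum>j\<in>A. pmf w j * ((a + \<mu> j)\<^sup>2 + v j))"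
    using v by (intro sum_ennreal) auto
  also have "(\<Sum>j\<in>A. pmf w j * ((a + \<mu> j)\<^sup>2 + v j))
      = (\<Sum>j\<in>A. pmf w j * ((\<mu> j)\<^sup>2 + v j) + 2 * a * (pmf w j * \<mu> j) + a\<^sup>2 * pmf w j)"
    by (intro sum.cong) (auto simp: power2_eq_square algebra_simps)
  also have "\<dots> = (\<Sum>j\<in>A. pmf w j * ((\<mu> j)\<^sup>2 + v j)) + 2 * a * ?\<mu> + a\<^sup>2 * (\<Sum>j\<in>A. pmf w j)"
    by (simp add: sum.distrib sum_distrib_left)
  also have "\<dots> = (a + ?\<mu>)\<^sup>2 + ?v" by (simp add: w1 power2_eq_square algebra_simps)
  finally show "(\<integral>\<^sup>+x. ennreal ((a + f x)\<^sup>2) \<partial>measure_pmf (w \<bind> g)) = ennreal ((a + ?\<mu>)\<^sup>2 + ?v)" .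
qed

text \<open>The value of the head is absorbed into the shift \<open>a\<close> when the tail is
  integrated, and the mean of the tail when the head is. This is where moments for all
  \<open>a\<close> at once pay off.\<close>

lemma quad_moments_replicate:
  assumes "quad_moments p f \<mu> v"
  shows "quad_moments (replicate_pmf n p) (\<lambda>xs. \<Sum>x\<leftarrow>xs. f x) (real n * \<mu>) (real n * v)"
proof (induction n)
  case (Suc n)
  have v: "v \<ge> 0" and f: "\<And>a. (\<integral>\<^sup>+x. ennreal ((a + f x)\<^sup>2) \<partial>measure_pmf p) = ennreal ((a + \<mu>)\<^sup>2 + v)"
    using assms by (auto simp: quad_moments_def)
  have "(\<integral>\<^sup>+xs. ennreal ((a + (\<Sum>x\<leftarrow>xs. f x))\<^sup>2) \<partial>measure_pmf (replicate_pmf (Suc n) p))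
      = ennreal ((a + real (Suc n) * \<mu>)\<^sup>2 + real (Suc n) * v)" for a
  proof -
    have "(\<integral>\<^sup>+xs. ennreal ((a + (\<Sum>x\<leftarrow>xs. f x))\<^sup>2) \<partial>measure_pmf (replicate_pmf (Suc n) p))
        = (\<integral>\<^sup>+x. \<integral>\<^sup>+xs. ennreal ((a + f x + (\<Sum>x\<leftarrow>xs. f x))\<^sup>2) \<partial>measure_pmf (replicate_pmf n p) \<partial>measure_pmf p)"
      by (simp add: add.assoc)
    also have "\<dots> = (\<integral>\<^sup>+x. ennreal ((a + f x + real n * \<mu>)\<^sup>2 + real n * v) \<partial>measure_pmf p)"
      using Suc by (simp add: quad_moments_def)
    also have "\<dots> = (\<integral>\<^sup>+x. ennreal (((a + real n * \<mu>) + f x)\<^sup>2) + ennreal (real n * v) \<partial>measure_pmf p)"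
      using v by (intro nn_integral_cong) (simp add: add_ac flip: ennreal_plus)
    also have "\<dots> = ennreal ((a + real n * \<mu> + \<mu>)\<^sup>2 + v) + ennreal (real n * v)"
      by (simp add: nn_integral_add f)
    also have "\<dots> = ennreal ((a + real (Suc n) * \<mu>)\<^sup>2 + real (Suc n) * v)"
      using v by (simp add: algebra_simps flip: ennreal_plus)
    finally show ?thesis .
  qed
  then show ?case using v unfolding quad_moments_def by simp
qed (simp add: quad_moments_def)

text \<open>The mass at \<open>n + 1\<close> times \<open>n + 1\<close> is \<open>d\<close> times
  the mass at \<open>n\<close>, which reduces each moment to those of lower order.\<close>

lemma poisson_pmf_sums:
  assumes d: "d > 0"
  shows "pmf (poisson_pmf d) sums 1"
    and "(\<lambda>n. pmf (poisson_pmf d) n * real n) sums d"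
    and "(\<lambda>n. pmf (poisson_pmf d) n * (real n)\<^sup>2) sums (d + d\<^sup>2)"
proof -
  let ?\<pi> = "pmf (poisson_pmf d)"
  have "(\<lambda>n. exp (- d) * (d ^ n /\<^sub>R fact n)) sums (exp (- d) * exp d)"
    by (intro sums_mult exp_converges)
  then show 0: "?\<pi> sums 1"
    using d by (subst sums_cong[where g = "\<lambda>n. exp (- d) * (d ^ n /\<^sub>R fact n)"])
      (simp_all add: field_simps flip: exp_add)
  have Suc: "?\<pi> (Suc n) * real (Suc n) = d * ?\<pi> n" for n
    using d by (simp add: field_simps del: of_nat_Suc)
  have "(\<lambda>n. ?\<pi> (Suc n) * real (Suc n)) sums d"
    using sums_mult[OF 0, of d] unfolding Suc by simp
  from sums_Suc[OF this] show 1: "(\<lambda>n. ?\<pi> n * real n) sums d" by simp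
  have Suc2: "?\<pi> (Suc n) * (real (Suc n))\<^sup>2 = d * (?\<pi> n * real n + ?\<pi> n)" for n
    unfolding power2_eq_square mult.assoc[symmetric] Suc by (simp add: algebra_simps del: pmf_poisson)
  have "(\<lambda>n. ?\<pi> (Suc n) * (real (Suc n))\<^sup>2) sums (d + d\<^sup>2)"
    using sums_mult[OF sums_add[OF 1 0], of d] unfolding Suc2
    by (simp add: algebra_simps power2_eq_square del: pmf_poisson)
  from sums_Suc[OF this] show "(\<lambda>n. ?\<pi> n * (real n)\<^sup>2) sums (d + d\<^sup>2)" by simp
qed

text \<open>For a compound Poisson sum the random number of terms adds
  \<open>d * \<mu>\<^sup>2\<close> to the variance, which becomes \<open>d\<close> times the second
  moment of one term.\<close>

lemma quad_moments_poisson_list: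
  assumes d: "d > 0" and p: "quad_moments p f \<mu> v"
  shows "quad_moments (poisson_list d p) (\<lambda>xs. \<Sum>x\<leftarrow>xs. f x) (d * \<mu>) (d * (\<mu>\<^sup>2 + v))"
proof -
  have v: "v \<ge> 0" using p by (simp add: quad_moments_def)
  have "(\<integral>\<^sup>+xs. ennreal ((a + (\<Sum>x\<leftarrow>xs. f x))\<^sup>2) \<partial>measure_pmf (poisson_list d p))
      = ennreal ((a + d * \<mu>)\<^sup>2 + d * (\<mu>\<^sup>2 + v))" for a
  proof -
    let ?\<pi> = "pmf (poisson_pmf d)"
    have "(\<integral>\<^sup>+xs. ennreal ((a + (\<Sum>x\<leftarrow>xs. f x))\<^sup>2) \<partial>measure_pmf (poisson_list d p))
        = (\<integral>\<^sup>+n. ennreal ((a + real n * \<mu>)\<^sup>2 + real n * v) \<partial>measure_pmf (poisson_pmf d))"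
      using quad_moments_replicate[OF p] by (simp add: poisson_list_def quad_moments_def)
    also have "\<dots> = (\<Sum>n. ennreal (?\<pi> n * ((a + real n * \<mu>)\<^sup>2 + real n * v)))"
      using v by (simp add: nn_integral_measure_pmf nn_integral_count_space_nat ennreal_mult del: pmf_poisson ennreal_plus)
    also have "\<dots> = ennreal (a\<^sup>2 * 1 + (2 * a * \<mu> + v) * d + \<mu>\<^sup>2 * (d + d\<^sup>2))"
    proof (rule suminf_ennreal_eq)
      have "(\<lambda>n. a\<^sup>2 * ?\<pi> n + (2 * a * \<mu> + v) * (?\<pi> n * real n) + \<mu>\<^sup>2 * (?\<pi> n * (real n)\<^sup>2))
          sums (a\<^sup>2 * 1 + (2 * a * \<mu> + v) * d + \<mu>\<^sup>2 * (d + d\<^sup>2))"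
        by (intro sums_add sums_mult poisson_pmf_sums d)
      also have "(\<lambda>n. a\<^sup>2 * ?\<pi> n + (2 * a * \<mu> + v) * (?\<pi> n * real n) + \<mu>\<^sup>2 * (?\<pi> n * (real n)\<^sup>2))
          = (\<lambda>n. ?\<pi> n * ((a + real n * \<mu>)\<^sup>2 + real n * v))"
        by (simp add: power2_eq_square algebra_simps del: pmf_poisson)
      finally show "(\<lambda>n. ?\<pi> n * ((a + real n * \<mu>)\<^sup>2 + real n * v))
          sums (a\<^sup>2 * 1 + (2 * a * \<mu> + v) * d + \<mu>\<^sup>2 * (d + d\<^sup>2))" .
    qed (use v in simp)
    also have "a\<^sup>2 * 1 + (2 * a * \<mu> + v) * d + \<mu>\<^sup>2 * (d + d\<^sup>2) = (a + d * \<mu>)\<^sup>2 + d * (\<mu>\<^sup>2 + v)"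
      by (simp add: power2_eq_square algebra_simps)
    finally show ?thesis .
  qed
  then show ?thesis using d v by (simp add: quad_moments_def)
qed

lemma quad_moments_Chebyshev:
  assumes p: "quad_moments p f \<mu> v" and e: "e > 0"
  shows "measure_pmf.prob p {x. e \<le> \<bar>f x - \<mu>\<bar>} \<le> v / e\<^sup>2"
proof -
  have v: "v \<ge> 0" using p by (simp add: quad_moments_def)
  have eq: "{x. e \<le> \<bar>f x - \<mu>\<bar>} = {x \<in> UNIV. 1 \<le> ennreal (1 / e\<^sup>2) * ennreal ((- \<mu> + f x)\<^sup>2)}"
  proof -
    have "e \<le> \<bar>f x - \<mu>\<bar> \<longleftrightarrow> 1 \<le> 1 / e\<^sup>2 * (- \<mu> + f x)\<^sup>2" for x
    proof -
      have "e \<le> \<bar>f x - \<mu>\<bar> \<longleftrightarrow> e\<^sup>2 \<le> (f x - \<mu>)\<^sup>2" using e by (metis abs_le_square_iff abs_of_pos)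
      then show ?thesis using e by (simp add: field_simps)
    qed
    then show ?thesis by (simp flip: ennreal_mult)
  qed
  have "emeasure p {x. e \<le> \<bar>f x - \<mu>\<bar>}
      \<le> ennreal (1 / e\<^sup>2) * (\<integral>\<^sup>+x. ennreal ((- \<mu> + f x)\<^sup>2) * indicator UNIV x \<partial>measure_pmf p)"
    unfolding eq by (rule nn_integral_Markov_inequality) auto
  also have "\<dots> = ennreal (v / e\<^sup>2)"
    using p[unfolded quad_moments_def, THEN conjunct2, rule_format, of "- \<mu>"] v
    by (simp flip: ennreal_mult)
  finally show ?thesis using v by (simp add: measure_pmf.emeasure_eq_measure)
qed

section \<open>Views of the broadcast process\<close>

text \<open>
  The law of the observed view given the root label, where level-\<open>m\<close> labels pass through a channel
  \<open>\<nu>\<close>: \<open>return_pmf\<close> for $\sigma$ and the rows of the noise matrix for $\tau$.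
\<close>

primrec view_law :: "(nat \<Rightarrow> nat pmf) \<Rightarrow> real \<Rightarrow> real mat \<Rightarrow> nat \<Rightarrow> nat \<Rightarrow> nat option rtree pmf" where
  "view_law \<nu> d P 0 i = map_pmf (\<lambda>j. Node (Some j) []) (\<nu> i)"
| "view_law \<nu> d P (Suc m) i = map_pmf (Node None) (poisson_list d (row_pmf P i \<bind> view_law \<nu> d P m))"

lemma map_pmf_poisson_list: "map_pmf (map f) (poisson_list d p) = poisson_list d (map_pmf f p)"
  by (simp add: poisson_list_def map_bind_pmf map_pmf_map_replicate_pmf)

lemma broadcast_Suc:
  "broadcast d P (Suc m) i = map_pmf (Node i) (poisson_list d (row_pmf P i \<bind> broadcast d P m))"
  by (simp add: poisson_list_def map_pmf_def bind_assoc_pmf)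

lemma root_label_broadcast: "t \<in> set_pmf (broadcast d P m i) \<Longrightarrow> root_label t = i"
  by (cases m) auto

lemma level_view_broadcast:
  "map_pmf (level_view m) (broadcast d P m i) = view_law return_pmf d P m i"
proof (induction m arbitrary: i)
  case (Suc m)
  have "map_pmf (level_view (Suc m)) (broadcast d P (Suc m) i)
      = map_pmf (Node None) (map_pmf (map (level_view m)) (poisson_list d (row_pmf P i \<bind> broadcast d P m)))"
    unfolding broadcast_Suc by (simp add: pmf.map_comp o_def)
  also have "\<dots> = view_law return_pmf d P (Suc m) i"
    by (simp add: map_pmf_poisson_list map_bind_pmf Suc)
  finally show ?case .
qed simp

text \<open>Independent draws commute, so the noise of the first entry can be drawn before the
  remaining entries.\<close>

lemma sequence_pmf_replicate_pmf:
  "replicate_pmf n p \<bind> (\<lambda>xs. sequence_pmf (map g xs)) = replicate_pmf n (p \<bind> g)"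
proof (induction n)
  case (Suc n)
  have "replicate_pmf (Suc n) p \<bind> (\<lambda>xs. sequence_pmf (map g xs))
      = p \<bind> (\<lambda>x. replicate_pmf n p \<bind> (\<lambda>xs. g x \<bind> (\<lambda>y. sequence_pmf (map g xs) \<bind> (\<lambda>ys. return_pmf (y # ys)))))"
    by (simp add: bind_assoc_pmf bind_return_pmf)
  also have "\<dots> = p \<bind> (\<lambda>x. g x \<bind> (\<lambda>y. replicate_pmf n p \<bind> (\<lambda>xs. sequence_pmf (map g xs) \<bind> (\<lambda>ys. return_pmf (y # ys)))))"
    by (subst bind_commute_pmf) (rule refl)
  also have "\<dots> = (p \<bind> g) \<bind> (\<lambda>y. (replicate_pmf n p \<bind> (\<lambda>xs. sequence_pmf (map g xs))) \<bind> (\<lambda>ys. return_pmf (y # ys)))"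
    by (simp add: bind_assoc_pmf)
  finally show ?case by (simp add: Suc)
qed (simp add: bind_return_pmf)

lemma map_pmf_sequence_pmf:
  "map_pmf (map h) (sequence_pmf ps) = sequence_pmf (map (map_pmf h) ps)"
proof (induction ps)
  case (Cons p ps)
  then show ?case
    by (simp add: map_bind_pmf bind_map_pmf flip: Cons.IH)
qed simp

text \<open>The view erases the noisy labels above level \<open>m\<close>, so each noise draw there
  integrates out and \<open>D\<close> acts at level \<open>m\<close> only.\<close>

lemma level_view_noisy:
  "broadcast d P m i \<bind> (\<lambda>s. map_pmf (level_view m) (noisy D s)) = view_law (row_pmf D) d P m i"
proof (induction m arbitrary: i)
  case 0
  show ?case by (simp add: bind_return_pmf map_bind_pmf) (simp add: map_pmf_def)
next
  case (Suc m)
  let ?g = "\<lambda>s. map_pmf (level_view m) (noisy D s)"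
  have *: "map_pmf (level_view (Suc m)) (noisy D (Node i ts)) = map_pmf (Node None) (sequence_pmf (map ?g ts))" for ts
  proof -
    have "map_pmf (level_view (Suc m)) (noisy D (Node i ts))
        = map_pmf (Node None) (map_pmf (map (level_view m)) (sequence_pmf (map (noisy D) ts)))"
      by (simp add: map_bind_pmf) (simp add: map_pmf_def bind_assoc_pmf bind_return_pmf)
    then show ?thesis by (simp add: map_pmf_sequence_pmf o_def)
  qed
  have "broadcast d P (Suc m) i \<bind> (\<lambda>s. map_pmf (level_view (Suc m)) (noisy D s))
      = map_pmf (Node None) (poisson_pmf d \<bind> (\<lambda>n. replicate_pmf n (row_pmf P i \<bind> broadcast d P m)
          \<bind> (\<lambda>ts. sequence_pmf (map ?g ts))))"
    unfolding broadcast_Suc bind_map_pmf * by (simp add: poisson_list_def bind_assoc_pmf map_bind_pmf)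
  also have "\<dots> = view_law (row_pmf D) d P (Suc m) i"
    by (simp add: sequence_pmf_replicate_pmf bind_assoc_pmf Suc poisson_list_def)
  finally show ?case .
qed

text \<open>Given \<open>i\<close> the root label is deterministic, which yields the form of joint
  law that \<open>bayes_optimal_ge\<close> expects.\<close>

lemma clean_law_joint:
  "map_pmf (\<lambda>t. (root_label t, level_view m t)) (clean_law \<pi> d P m)
     = \<pi> \<bind> (\<lambda>i. map_pmf (Pair i) (view_law return_pmf d P m i))"
proof -
  have "map_pmf (\<lambda>t. (root_label t, level_view m t)) (broadcast d P m i)
      = map_pmf (Pair i) (map_pmf (level_view m) (broadcast d P m i))" for i
    by (auto simp: pmf.map_comp o_def root_label_broadcast intro!: map_pmf_cong)
  then show ?thesis by (simp add: clean_law_def map_bind_pmf level_view_broadcast)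
qed

lemma noisy_law_joint:
  "map_pmf (\<lambda>x. (root_label (fst x), level_view m (snd x))) (noisy_law \<pi> d P D m)
     = \<pi> \<bind> (\<lambda>i. map_pmf (Pair i) (view_law (row_pmf D) d P m i))"
proof -
  have "broadcast d P m i \<bind> (\<lambda>s. map_pmf (\<lambda>t. (root_label s, level_view m t)) (noisy D s))
      = broadcast d P m i \<bind> (\<lambda>s. map_pmf (Pair i) (map_pmf (level_view m) (noisy D s)))" for i
    by (auto simp: pmf.map_comp o_def root_label_broadcast intro!: bind_pmf_cong)
  also have "\<dots> i = map_pmf (Pair i) (view_law (row_pmf D) d P m i)" for i
    by (simp add: map_bind_pmf flip: level_view_noisy)
  finally show ?thesis
    by (simp add: noisy_law_def clean_law_def map_bind_pmf bind_assoc_pmf) (simp add: map_pmf_def)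
qed

section \<open>Moments of eigenvector sums over a level\<close>

primrec level_sum :: "(nat \<Rightarrow> real) \<Rightarrow> nat \<Rightarrow> nat option rtree \<Rightarrow> real" where
  "level_sum \<eta> 0 t = \<eta> (the (root_label t))"
| "level_sum \<eta> (Suc m) t = (\<Sum>t'\<leftarrow>subtrees t. level_sum \<eta> m t')"

lemma set_pmf_row_pmf:
  assumes "stochastic_mat q A" "i < q"
  shows "set_pmf (row_pmf A i) \<subseteq> {..<q}"
  using pmf_row_pmf[OF assms] by (auto simp: set_pmf_iff split: if_splits)

text \<open>The eigenvector equation multiplies the mean by \<open>d * \<theta>\<close> per
  generation. With \<open>L = \<theta>\<^sup>2 * d\<close>, a bound \<open>R\<close> on the variance
  relative to the squared growth factor becomes \<open>(B + R) / L\<close>. The form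
  \<open>2 * B / L + B' / L ^ m\<close> survives this step because \<open>L \<ge> 2\<close>, and the
  leaf variance decays geometrically.\<close>

lemma quad_moments_level_sum:
  assumes P: "stochastic_mat q P" and d: "d > 0"
    and eig: "\<And>i. i < q \<Longrightarrow> (\<Sum>j<q. P $$ (i, j) * \<xi> j) = \<theta> * \<xi> i"
    and lam: "\<theta>\<^sup>2 * d \<ge> 2"
    and B: "\<And>i. i < q \<Longrightarrow> (\<xi> i)\<^sup>2 \<le> B"
    and leaf: "\<And>i. i < q \<Longrightarrow> \<exists>v\<le>B'. quad_moments (\<nu> i) \<eta> (\<xi> i) v"
    and i: "i < q"
  shows "\<exists>v. quad_moments (view_law \<nu> d P m i) (level_sum \<eta> m) ((d * \<theta>) ^ m * \<xi> i) v \<and>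
     v \<le> ((d * \<theta>) ^ m)\<^sup>2 * (2 * B / (\<theta>\<^sup>2 * d) + B' / (\<theta>\<^sup>2 * d) ^ m)"
  using i
proof (induction m arbitrary: i)
  case 0
  obtain v where v: "v \<le> B'" "quad_moments (\<nu> i) \<eta> (\<xi> i) v" using leaf[OF 0] by auto
  have "0 \<le> B" using B[OF 0] by (meson order_trans zero_le_power2)
  then have "0 \<le> 2 * B / (\<theta>\<^sup>2 * d)" using d by simp
  then show ?case using v by (auto simp: quad_moments_map)
next
  case (Suc m)
  define L where "L = \<theta>\<^sup>2 * d"
  define s where "s = (d * \<theta>) ^ m"
  define R where "R = 2 * B / L + B' / L ^ m"
  have L: "L \<ge> 2" using lam by (simp add: L_def)
  have B0: "0 \<le> B" using B[OF Suc.prems] by (meson order_trans zero_le_power2)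
  from Suc.IH obtain v where v: "\<And>j. j < q \<Longrightarrow> quad_moments (view_law \<nu> d P m j) (level_sum \<eta> m) (s * \<xi> j) (v j)"
    "\<And>j. j < q \<Longrightarrow> v j \<le> s\<^sup>2 * R"
    unfolding s_def R_def L_def by metis
  have p: "pmf (row_pmf P i) j = P $$ (i, j)" if "j < q" for j
    using that by (simp add: pmf_row_pmf[OF P Suc.prems])
  have Pn: "0 \<le> P $$ (i, j)" if "j < q" for j using P that Suc.prems by (auto simp: stochastic_mat_def)
  have P1: "(\<Sum>j<q. P $$ (i, j)) = 1" using P Suc.prems by (auto simp: stochastic_mat_def)
  let ?\<mu> = "\<Sum>j<q. pmf (row_pmf P i) j * (s * \<xi> j)"
  let ?S = "\<Sum>j<q. pmf (row_pmf P i) j * ((s * \<xi> j)\<^sup>2 + v j)"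
  have "quad_moments (row_pmf P i \<bind> view_law \<nu> d P m) (level_sum \<eta> m) ?\<mu> (?S - ?\<mu>\<^sup>2)"
    using v(1) by (intro quad_moments_bind set_pmf_row_pmf[OF P Suc.prems]) auto
  from quad_moments_poisson_list[OF d this]
  \<comment> \<open>The squared mean added by the Poisson sum cancels the one subtracted by the
    mixture.\<close>
  have "quad_moments (view_law \<nu> d P (Suc m) i) (level_sum \<eta> (Suc m)) (d * ?\<mu>) (d * ?S)"
    by (simp add: quad_moments_map)
  moreover have "d * ?\<mu> = (d * \<theta>) ^ Suc m * \<xi> i"
  proof -
    have "?\<mu> = s * (\<theta> * \<xi> i)"
      unfolding eig[OF Suc.prems, symmetric] by (simp add: p sum_distrib_left mult_ac)
    then show ?thesis by (simp only: s_def power_Suc) (simp add: mult_ac)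
  qed
  moreover have "d * ?S \<le> ((d * \<theta>) ^ Suc m)\<^sup>2 * (2 * B / L + B' / L ^ Suc m)"
  proof -
    have "?S \<le> (\<Sum>j<q. P $$ (i, j) * (s\<^sup>2 * (B + R)))"
    proof (intro sum_mono)
      fix j assume j: "j \<in> {..<q}"
      have "s\<^sup>2 * (\<xi> j)\<^sup>2 \<le> s\<^sup>2 * B" using B j by (intro mult_left_mono) auto
      then have "(s * \<xi> j)\<^sup>2 + v j \<le> s\<^sup>2 * (B + R)"
        using v(2)[of j] j by (simp add: power_mult_distrib algebra_simps)
      then show "pmf (row_pmf P i) j * ((s * \<xi> j)\<^sup>2 + v j) \<le> P $$ (i, j) * (s\<^sup>2 * (B + R))"
        using Pn j by (simp add: p mult_left_mono)
    qed
    also have "\<dots> = s\<^sup>2 * (B + R)" by (simp add: P1 flip: sum_distrib_right)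
    finally have "d * ?S \<le> d * (s\<^sup>2 * (B + R))" using d by (simp add: mult_left_mono)
    also have "\<dots> = (d * s\<^sup>2 * L) * ((B + R) / L)" using L by simp
    also have "d * s\<^sup>2 * L = ((d * \<theta>) ^ Suc m)\<^sup>2"
      by (simp add: L_def s_def power2_eq_square mult_ac)
    also have "(B + R) / L = B / L + (2 * B / L) / L + B' / L ^ Suc m"
      by (simp add: R_def add_divide_distrib)
    also have "(2 * B / L) / L \<le> B / L"
      using L mult_left_mono[OF L B0] by (intro divide_right_mono) (auto simp: field_simps)
    finally show ?thesis by (simp add: mult_left_mono)
  qed
  ultimately show ?case unfolding L_def by (intro exI[of _ "d * ?S"] conjI) (simp_all only:)
qed

section \<open>From guessing labels to separating the views of neighbouring generations\<close>

lemma prob_bind_pmf: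
  assumes A: "finite A" "set_pmf w \<subseteq> A"
  shows "measure_pmf.prob (w \<bind> g) S = (\<Sum>j\<in>A. pmf w j * measure_pmf.prob (g j) S)"
proof -
  have "ennreal (measure_pmf.prob (w \<bind> g) S) = (\<integral>\<^sup>+j. emeasure (g j) S \<partial>measure_pmf w)"
    by (simp flip: measure_pmf.emeasure_eq_measure)
  also have "\<dots> = (\<Sum>j\<in>A. emeasure (g j) S * pmf w j)"
    using A by (intro nn_integral_measure_pmf_support) auto
  also have "\<dots> = (\<Sum>j\<in>A. ennreal (pmf w j * measure_pmf.prob (g j) S))"
    by (simp add: measure_pmf.emeasure_eq_measure mult.commute ennreal_mult)
  also have "\<dots> = ennreal (\<Sum>j\<in>A. pmf w j * measure_pmf.prob (g j) S)"
    by (intro sum_ennreal) auto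
  finally show ?thesis by (subst (asm) ennreal_inj) (auto intro!: sum_nonneg)
qed

text \<open>With \<open>v\<close> the difference of the two rows, \<open>A\<close> has probability
  at least 3/4 under \<open>g l\<close> if \<open>v l > 0\<close> and at most 1/4 otherwise. Either
  way label \<open>l\<close> contributes at least \<open>v l / 2 + \<bar>v l\<bar> / 4\<close>, and
  the first summands cancel because both rows sum to 1.\<close>

lemma prob_diff_ge_row_dist1:
  assumes P: "stochastic_mat q P" and ij: "i < q" "j < q"
    and f: "\<And>l. l < q \<Longrightarrow> measure_pmf.prob (g l) {x. f x = l} \<ge> 3 / 4"
  obtains A where "measure_pmf.prob (row_pmf P i \<bind> g) A - measure_pmf.prob (row_pmf P j \<bind> g) A
     \<ge> row_dist1 q P i j / 4"
proof
  define v where "v l = P $$ (i, l) - P $$ (j, l)" for l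
  \<comment> \<open>the event where the likelihood test based on the guessed label prefers \<open>i\<close>\<close>
  define A where "A = {x. v (f x) > 0}"
  have prob: "measure_pmf.prob (row_pmf P i \<bind> g) A = (\<Sum>l<q. P $$ (i, l) * measure_pmf.prob (g l) A)"
    if "i < q" for i
    using that by (subst prob_bind_pmf[OF _ set_pmf_row_pmf[OF P that]]) (auto simp: pmf_row_pmf[OF P])
  have "(\<Sum>l<q. v l) = 0" using P ij by (simp add: v_def sum_subtractf stochastic_mat_def)
  then have "row_dist1 q P i j / 4 = (\<Sum>l<q. v l / 2 + \<bar>v l\<bar> / 4)"
    by (simp add: row_dist1_def v_def sum.distrib flip: sum_divide_distrib)
  also have "\<dots> \<le> (\<Sum>l<q. v l * measure_pmf.prob (g l) A)"
  proof (intro sum_mono)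
    fix l assume l: "l \<in> {..<q}"
    show "v l / 2 + \<bar>v l\<bar> / 4 \<le> v l * measure_pmf.prob (g l) A"
    proof (cases "v l > 0")
      case True
      then have "{x. f x = l} \<subseteq> A" by (auto simp: A_def)
      then have "measure_pmf.prob (g l) {x. f x = l} \<le> measure_pmf.prob (g l) A"
        by (intro measure_pmf.finite_measure_mono) auto
      with f[of l] l have "3 / 4 \<le> measure_pmf.prob (g l) A" by simp
      then have "v l * (3 / 4) \<le> v l * measure_pmf.prob (g l) A" using True by (intro mult_left_mono) auto
      then show ?thesis using True by simp
    next
      case False
      then have "{x. f x = l} \<subseteq> - A" by (auto simp: A_def)
      then have "measure_pmf.prob (g l) {x. f x = l} \<le> measure_pmf.prob (g l) (- A)"
        by (intro measure_pmf.finite_measure_mono) auto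
      with f[of l] l have "measure_pmf.prob (g l) A \<le> 1 / 4"
        using measure_pmf.prob_compl[of A "g l"] by (simp add: Compl_eq_Diff_UNIV)
      then have "v l * (1 / 4) \<le> v l * measure_pmf.prob (g l) A" using False by (intro mult_left_mono_neg) auto
      then show ?thesis using False by simp
    qed
  qed
  also have "\<dots> = measure_pmf.prob (row_pmf P i \<bind> g) A - measure_pmf.prob (row_pmf P j \<bind> g) A"
    by (simp add: prob ij v_def sum_subtractf left_diff_distrib)
  finally show "row_dist1 q P i j / 4 \<le> \<dots>" .
qed

text \<open>Two labels both within \<open>\<delta> / 2\<close> of every statistic would violate the
  separation, so a compatible label is unique. The true label is compatible outside a union of at
  most \<open>q\<close> events, each of probability at most \<open>1 / (4 * real q)\<close>.\<close>

lemma ex_estimator: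
  fixes T :: "nat \<Rightarrow> 'a \<Rightarrow> real"
  assumes G: "G \<subseteq> {..<q}"
    and dist: "\<And>i j. i < q \<Longrightarrow> j < q \<Longrightarrow> i \<noteq> j \<Longrightarrow> \<exists>l\<in>G. \<bar>\<xi> l i - \<xi> l j\<bar> > \<delta>"
    and T: "\<And>l i. l \<in> G \<Longrightarrow> i < q \<Longrightarrow> measure_pmf.prob (p i) {x. \<delta> / 2 \<le> \<bar>T l x - \<xi> l i\<bar>} \<le> 1 / (4 * real q)"
  obtains f :: "'a \<Rightarrow> nat" where "\<And>i. i < q \<Longrightarrow> measure_pmf.prob (p i) {x. f x = i} \<ge> 3 / 4"
proof
  define good where "good x i \<longleftrightarrow> i < q \<and> (\<forall>l\<in>G. \<bar>T l x - \<xi> l i\<bar> < \<delta> / 2)" for x i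
  \<comment> \<open>If no label is compatible, the value is arbitrary; such outcomes lie in the
    deviation events bounded below.\<close>
  define f where "f x = (SOME i. good x i)" for x
  have f: "f x = i" if gi: "good x i" for x i
  proof (rule ccontr)
    assume "f x \<noteq> i"
    moreover have "good x (f x)" unfolding f_def using gi by (rule someI)
    ultimately obtain l where "l \<in> G" "\<bar>\<xi> l (f x) - \<xi> l i\<bar> > \<delta>"
      using dist gi unfolding good_def by blast
    moreover from this have "\<bar>T l x - \<xi> l (f x)\<bar> < \<delta> / 2" "\<bar>T l x - \<xi> l i\<bar> < \<delta> / 2"
      using gi \<open>good x (f x)\<close> unfolding good_def by blast+
    ultimately show False by linarith
  qed
  fix i assume i: "i < q"
  have fin: "finite G" "card G \<le> q" using G by (auto intro: finite_subset dest: card_mono[rotated])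
  have "- {x. f x = i} \<subseteq> (\<Union>l\<in>G. {x. \<delta> / 2 \<le> \<bar>T l x - \<xi> l i\<bar>})"
    using f i unfolding good_def by force
  then have "measure_pmf.prob (p i) (- {x. f x = i})
      \<le> measure_pmf.prob (p i) (\<Union>l\<in>G. {x. \<delta> / 2 \<le> \<bar>T l x - \<xi> l i\<bar>})"
    by (intro measure_pmf.finite_measure_mono) auto
  also have "\<dots> \<le> (\<Sum>l\<in>G. measure_pmf.prob (p i) {x. \<delta> / 2 \<le> \<bar>T l x - \<xi> l i\<bar>})"
    using fin by (intro measure_pmf.finite_measure_subadditive_finite) auto
  also have "\<dots> \<le> (\<Sum>l\<in>G. 1 / (4 * real q))" using T i by (intro sum_mono) auto
  also have "\<dots> = real (card G) * (1 / (4 * real q))" by simp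
  also have "\<dots> \<le> real q * (1 / (4 * real q))" using fin by (intro mult_right_mono) auto
  also have "\<dots> = 1 / 4" using i by simp
  finally show "3 / 4 \<le> measure_pmf.prob (p i) {x. f x = i}"
    using measure_pmf.prob_compl[of "{x. f x = i}" "p i"] by (simp add: Compl_eq_Diff_UNIV)
qed

text \<open>The views below a single child differ by at least \<open>r / 4\<close> on some event, so
  \<open>bhatt_le\<close> leaves a deficit of \<open>(r / 4)\<^sup>2 / 2\<close>. This is the source
  of the 32; the Poisson number of children puts the deficit into the exponent.\<close>

lemma bhatt_view_law_Suc:
  assumes P: "stochastic_mat q P" and d: "d > 0" and ij: "i < q" "j < q"
    and f: "\<And>l. l < q \<Longrightarrow> measure_pmf.prob (view_law \<nu> d P m l) {x. f x = l} \<ge> 3 / 4"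
    and r: "0 \<le> r" "r \<le> row_dist1 q P i j"
  shows "bhatt (view_law \<nu> d P (Suc m) i) (view_law \<nu> d P (Suc m) j) \<le> ennreal (exp (- (r\<^sup>2 / 32 * d)))"
proof -
  let ?Q = "\<lambda>i. row_pmf P i \<bind> view_law \<nu> d P m"
  obtain A where A: "row_dist1 q P i j / 4 \<le> measure_pmf.prob (?Q i) A - measure_pmf.prob (?Q j) A"
    using prob_diff_ge_row_dist1[OF P ij, of "view_law \<nu> d P m" f] f by metis
  define t where "t = measure_pmf.prob (?Q i) A - measure_pmf.prob (?Q j) A"
  have "r / 4 \<le> t" using A r by (simp add: t_def)
  then have "(r / 4)\<^sup>2 \<le> t\<^sup>2" using r by (intro power_mono) auto
  then have t: "r\<^sup>2 / 16 \<le> t\<^sup>2" by (simp add: power_divide)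
  \<comment> \<open>This keeps \<open>1 - t\<^sup>2 / 2\<close> nonnegative, so the bound in
    \<open>ennreal\<close> can be read as one between reals.\<close>
  have "\<bar>t\<bar> \<le> 1" unfolding t_def
    using measure_nonneg[of "?Q i" A] measure_nonneg[of "?Q j" A]
      measure_pmf.prob_le_1[of "?Q i" A] measure_pmf.prob_le_1[of "?Q j" A] by linarith
  then have t1: "t\<^sup>2 \<le> 1" by (simp add: abs_square_le_1)
  have le: "bhatt (?Q i) (?Q j) \<le> ennreal (1 - t\<^sup>2 / 2)" unfolding t_def by (rule bhatt_le)
  then obtain b where b: "bhatt (?Q i) (?Q j) = ennreal b" "b \<ge> 0"
    by (cases "bhatt (?Q i) (?Q j)") (auto simp: top_unique)
  have "b \<le> 1 - t\<^sup>2 / 2" using le b t1 by simp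
  then have "r\<^sup>2 / 32 \<le> 1 - b" using t by simp
  then have "r\<^sup>2 / 32 * d \<le> d * (1 - b)" using d by (simp add: mult.commute mult_left_mono)
  have "bhatt (view_law \<nu> d P (Suc m) i) (view_law \<nu> d P (Suc m) j) = ennreal (exp (- (d * (1 - b))))"
    by (simp add: bhatt_map_inj inj_on_def bhatt_poisson_list[OF d b])
  also have "\<dots> \<le> ennreal (exp (- (r\<^sup>2 / 32 * d)))"
    using \<open>r\<^sup>2 / 32 * d \<le> d * (1 - b)\<close> by (intro ennreal_leI) simp
  finally show ?thesis .
qed

section \<open>Spectral estimators\<close>

text \<open>The matrix \<open>X\<close> with the eigenvectors as columns is a right inverse of
  \<open>V\<close> by orthogonality of \<open>U\<close>. Hence it equals the left inverse
  \<open>W\<close>, and \<open>P * X = X * L\<close>. The size bound holds since the rows of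
  \<open>U\<close> are unit vectors.\<close>

lemma spectral_decomp_eigvec:
  assumes sd: "spectral_decomp q \<pi> P lam U" and \<pi>: "set_pmf \<pi> = {..<q}" and l: "l < q" and i: "i < q"
  shows "(\<Sum>j<q. P $$ (i, j) * eigvec \<pi> U l j) = lam ! l * eigvec \<pi> U l i"
    and "(eigvec \<pi> U l i)\<^sup>2 \<le> 1 / pmf \<pi> i"
proof -
  define V where "V = U * mat_diag q (\<lambda>i. sqrt (pmf \<pi> i))"
  define L where "L = mat_diag q (\<lambda>l. lam ! l)"
  define X where "X = Matrix.mat q q (\<lambda>(i, l). eigvec \<pi> U l i)"
  from sd obtain W where U: "U \<in> carrier_mat q q" "U * transpose_mat U = 1\<^sub>m q"
    and W: "similar_mat_wit P L W V"
    by (auto simp: spectral_decomp_def V_def L_def)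
  have L: "L \<in> carrier_mat q q" by (simp add: L_def)
  have V: "V \<in> carrier_mat q q" using U by (simp add: V_def mat_diag_mult_right[OF U(1)])
  have X: "X \<in> carrier_mat q q" by (simp add: X_def)
  note w = similar_mat_witD[OF refl W]
  have "dim_row P = q" using w(5) L by (metis carrier_matD(1))
  then have P: "P \<in> carrier_mat q q" "W \<in> carrier_mat q q" "W * V = 1\<^sub>m q" "P = W * L * V"
    using w by metis+
  have pos: "pmf \<pi> i > 0" if "i < q" for i using that \<pi> by (simp add: pmf_positive)
  have UU: "(\<Sum>i<q. U $$ (a, i) * U $$ (b, i)) = (if a = b then 1 else 0)" if "a < q" "b < q" for a b
  proof -
    have "(U * transpose_mat U) $$ (a, b) = (\<Sum>i<q. U $$ (a, i) * U $$ (b, i))"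
      using that U(1) by (simp add: scalar_prod_def lessThan_atLeast0)
    then show ?thesis using that by (simp add: U(2))
  qed
  have "V * X = 1\<^sub>m q"
  proof (rule eq_matI)
    fix a b assume ab: "a < dim_row (1\<^sub>m q :: real mat)" "b < dim_col (1\<^sub>m q :: real mat)"
    then have "(V * X) $$ (a, b) = (\<Sum>i<q. V $$ (a, i) * X $$ (i, b))"
      using V X by (simp add: scalar_prod_def lessThan_atLeast0)
    also have "\<dots> = (\<Sum>i<q. U $$ (a, i) * U $$ (b, i))"
    proof (intro sum.cong refl)
      fix i assume "i \<in> {..<q}"
      then show "V $$ (a, i) * X $$ (i, b) = U $$ (a, i) * U $$ (b, i)"
        using ab U(1) pos[of i] by (simp add: V_def X_def mat_diag_mult_right[OF U(1)] eigvec_def)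
    qed
    finally show "(V * X) $$ (a, b) = 1\<^sub>m q $$ (a, b)" using ab by (simp add: UU)
  qed (use V X in auto)
  then have VX: "W * (V * X) = W" using P by simp
  have "W * (V * X) = (W * V) * X" using P(2) V X by simp
  then have WX: "W = X" using VX X unfolding P(3) by simp
  have "P * X = W * L * (V * X)"
    unfolding P(4) by (rule assoc_mult_mat) (use P(2) V X L in auto)
  also have "\<dots> = X * L" unfolding \<open>V * X = 1\<^sub>m q\<close> WX using X L by simp
  finally have "(P * X) $$ (i, l) = (X * L) $$ (i, l)" by simp
  then show "(\<Sum>j<q. P $$ (i, j) * eigvec \<pi> U l j) = lam ! l * eigvec \<pi> U l i"
    using i l P(1) X
    by (simp add: scalar_prod_def lessThan_atLeast0 L_def mat_diag_mult_right[OF X]) (simp add: X_def mult.commute)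
  have "(U $$ (l, i))\<^sup>2 \<le> (\<Sum>i<q. (U $$ (l, i))\<^sup>2)" using i by (intro member_le_sum) auto
  also have "\<dots> = 1" using UU[OF l l] by (simp add: power2_eq_square)
  finally show "(eigvec \<pi> U l i)\<^sup>2 \<le> 1 / pmf \<pi> i"
    using pos[OF i] by (simp add: eigvec_def power_divide divide_right_mono)
qed

section \<open>Inverting the noise\<close>

lemma invertible_mat_solve_bounded:
  fixes D :: "real mat"
  assumes D: "D \<in> carrier_mat q q" "invertible_mat D"
  shows "\<exists>K. \<forall>\<xi> M. (\<forall>i<q. (\<xi> i)\<^sup>2 \<le> M) \<longrightarrow>
    (\<exists>\<eta>. (\<forall>i<q. (\<Sum>j<q. D $$ (i, j) * \<eta> j) = \<xi> i) \<and> (\<forall>j<q. (\<eta> j)\<^sup>2 \<le> K * M))"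
proof -
  from D obtain W where DW: "D * W = 1\<^sub>m q" "W * D = 1\<^sub>m (dim_row W)"
    by (auto simp: invertible_mat_def inverts_mat_def)
  then have W: "W \<in> carrier_mat q q"
    using D(1) by (metis carrier_matD(2) carrier_matI index_mult_mat(3) index_one_mat(3))
  have DW': "(\<Sum>j<q. D $$ (i, j) * W $$ (j, k)) = (if i = k then 1 else 0)" if "i < q" "k < q" for i k
  proof -
    have "(D * W) $$ (i, k) = (\<Sum>j<q. D $$ (i, j) * W $$ (j, k))"
      using that D(1) W by (simp add: scalar_prod_def lessThan_atLeast0)
    then show ?thesis using that by (simp add: DW(1))
  qed
  \<comment> \<open>The total absolute value of the entries of the inverse bounds each
    \<open>\<bar>\<eta> j\<bar>\<close> by \<open>S * sqrt M\<close> uniformly in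
    \<open>\<xi>\<close>, hence the factor \<open>S\<^sup>2\<close>.\<close>
  define S where "S = (\<Sum>j<q. \<Sum>k<q. \<bar>W $$ (j, k)\<bar>)"
  show ?thesis
  proof (intro exI[of _ "S\<^sup>2"] allI impI)
    fix \<xi> :: "nat \<Rightarrow> real" and M
    assume M: "\<forall>i<q. (\<xi> i)\<^sup>2 \<le> M"
    define \<eta> where "\<eta> j = (\<Sum>k<q. W $$ (j, k) * \<xi> k)" for j
    have "(\<Sum>j<q. D $$ (i, j) * \<eta> j) = \<xi> i" if "i < q" for i
    proof -
      have "(\<Sum>j<q. D $$ (i, j) * \<eta> j) = (\<Sum>k<q. (\<Sum>j<q. D $$ (i, j) * W $$ (j, k)) * \<xi> k)"
        unfolding \<eta>_def sum_distrib_left sum_distrib_right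
        by (subst sum.swap) (simp add: mult.assoc)
      also have "\<dots> = (\<Sum>k<q. if i = k then \<xi> k else 0)"
        using that by (intro sum.cong) (auto simp: DW')
      finally show ?thesis using that by simp
    qed
    moreover have "(\<eta> j)\<^sup>2 \<le> S\<^sup>2 * M" if "j < q" for j
    proof -
      have M0: "M \<ge> 0" using M that by (meson order_trans zero_le_power2)
      have "\<bar>\<eta> j\<bar> \<le> (\<Sum>k<q. \<bar>W $$ (j, k)\<bar> * \<bar>\<xi> k\<bar>)"
        unfolding \<eta>_def by (rule order_trans[OF sum_abs]) (simp add: abs_mult)
      also have "\<dots> \<le> (\<Sum>k<q. \<bar>W $$ (j, k)\<bar> * sqrt M)"
        using M by (intro sum_mono mult_left_mono) (auto intro: real_le_rsqrt)
      also have "\<dots> = (\<Sum>k<q. \<bar>W $$ (j, k)\<bar>) * sqrt M" by (simp add: sum_distrib_right)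
      also have "\<dots> \<le> S * sqrt M"
        unfolding S_def using that M0 by (intro mult_right_mono member_le_sum) (auto intro: sum_nonneg)
      finally have "\<bar>\<eta> j\<bar>\<^sup>2 \<le> (S * sqrt M)\<^sup>2" by (intro power_mono) auto
      then show ?thesis using M0 by (simp add: power_mult_distrib)
    qed
    ultimately show "\<exists>\<eta>. (\<forall>i<q. (\<Sum>j<q. D $$ (i, j) * \<eta> j) = \<xi> i) \<and> (\<forall>j<q. (\<eta> j)\<^sup>2 \<le> S\<^sup>2 * M)" by auto
  qed
qed

text \<open>
  \<open>lifts_moments\<close> expresses that the leaf noise \<open>\<nu>\<close> can be inverted in the mean, at the price of a
  variance factor \<open>K\<close>.
\<close>

definition lifts_moments :: "nat \<Rightarrow> real \<Rightarrow> (nat \<Rightarrow> nat pmf) \<Rightarrow> bool" where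
  "lifts_moments q K \<nu> \<longleftrightarrow> (\<forall>\<xi> M. (\<forall>i<q. (\<xi> i)\<^sup>2 \<le> M) \<longrightarrow>
     (\<exists>\<eta>. \<forall>i<q. \<exists>v\<le>K * M. quad_moments (\<nu> i) \<eta> (\<xi> i) v))"

lemma lifts_moments_return: "lifts_moments q 0 return_pmf"
  unfolding lifts_moments_def
proof (intro allI impI exI conjI)
  fix \<xi> :: "nat \<Rightarrow> real" and M :: real and i
  show "0 \<le> 0 * M" "quad_moments (return_pmf i) \<xi> (\<xi> i) 0" by (simp_all add: quad_moments_return)
qed

text \<open>The leaf function is the inverse of \<open>D\<close> applied to \<open>\<xi>\<close>.
  Averaging it over a row of \<open>D\<close> returns \<open>\<xi>\<close>, and its variance is at
  most its second moment.\<close>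

lemma ex_lifts_moments_row_pmf:
  assumes D: "stochastic_mat q D" "invertible_mat D"
  shows "\<exists>K. lifts_moments q K (row_pmf D)"
proof -
  from D obtain K where K: "\<And>\<xi> M. (\<forall>i<q. (\<xi> i)\<^sup>2 \<le> M) \<Longrightarrow>
    (\<exists>\<eta>. (\<forall>i<q. (\<Sum>j<q. D $$ (i, j) * \<eta> j) = \<xi> i) \<and> (\<forall>j<q. (\<eta> j)\<^sup>2 \<le> K * M))"
    using invertible_mat_solve_bounded[of D q] by (auto simp: stochastic_mat_def)
  have "lifts_moments q K (row_pmf D)"
    unfolding lifts_moments_def
  proof (intro allI impI)
    fix \<xi> :: "nat \<Rightarrow> real" and M
    assume "\<forall>i<q. (\<xi> i)\<^sup>2 \<le> M"
    from K[OF this] obtain \<eta> where \<eta>: "\<And>i. i < q \<Longrightarrow> (\<Sum>j<q. D $$ (i, j) * \<eta> j) = \<xi> i"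
      "\<And>j. j < q \<Longrightarrow> (\<eta> j)\<^sup>2 \<le> K * M" by auto
    show "\<exists>\<eta>. \<forall>i<q. \<exists>v\<le>K * M. quad_moments (row_pmf D i) \<eta> (\<xi> i) v"
    proof (intro exI[of _ \<eta>] allI impI)
      fix i assume i: "i < q"
      have p: "pmf (row_pmf D i) j = D $$ (i, j)" if "j < q" for j
        using that by (simp add: pmf_row_pmf[OF D(1) i])
      \<comment> \<open>Binding with \<open>return_pmf\<close> presents the row as a mixture of
        point masses of zero variance.\<close>
      have "quad_moments (row_pmf D i \<bind> return_pmf) \<eta> (\<Sum>j<q. pmf (row_pmf D i) j * \<eta> j)
        ((\<Sum>j<q. pmf (row_pmf D i) j * ((\<eta> j)\<^sup>2 + 0)) - (\<Sum>j<q. pmf (row_pmf D i) j * \<eta> j)\<^sup>2)"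
        by (intro quad_moments_bind set_pmf_row_pmf[OF D(1) i] quad_moments_return) auto
      then have "quad_moments (row_pmf D i) \<eta> (\<xi> i) ((\<Sum>j<q. D $$ (i, j) * (\<eta> j)\<^sup>2) - (\<xi> i)\<^sup>2)"
        using \<eta>(1)[OF i] by (simp add: p bind_return_pmf')
      moreover have "(\<Sum>j<q. D $$ (i, j) * (\<eta> j)\<^sup>2) \<le> (\<Sum>j<q. D $$ (i, j) * (K * M))"
        using D(1) i \<eta>(2) by (intro sum_mono mult_left_mono) (auto simp: stochastic_mat_def)
      moreover have "\<dots> = K * M" using D(1) i by (simp add: stochastic_mat_def flip: sum_distrib_right)
      ultimately show "\<exists>v\<le>K * M. quad_moments (row_pmf D i) \<eta> (\<xi> i) v"
        by (intro exI[of _ "(\<Sum>j<q. D $$ (i, j) * (\<eta> j)\<^sup>2) - (\<xi> i)\<^sup>2"]) (auto intro: order_trans[rotated])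
    qed
  qed
  then show ?thesis ..
qed

text \<open>
  The constant makes the Chebyshev bound for one eigenvector at most $1/(4q)$, so that a union
  bound over the eigenvectors leaves an error of at most $1/4$. Its summand 2 makes the variances
  of the level sums a convergent geometric series.
\<close>

definition KS_const :: "nat pmf \<Rightarrow> nat \<Rightarrow> real \<Rightarrow> real" where
  "KS_const \<pi> q \<delta> = 2 + 48 * real q * (\<Sum>i<q. 1 / pmf \<pi> i) / \<delta>\<^sup>2"

text \<open>The level sum divided by its growth factor \<open>s\<close> estimates the eigenvector
  entry, by one statistic for all root labels. As \<open>K \<le> 2 ^ m \<le> L ^ m\<close>, at depth
  \<open>m + 1\<close> the noise adds at most \<open>B / L\<close> to the relative variance, for a
  total of at most \<open>3 * B / L\<close>. Chebyshev at distance \<open>\<delta> / 2\<close> turns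
  3 into 12, and the 48 in \<open>KS_const\<close> is four times that.\<close>

lemma prob_level_sum_deviation:
  assumes P: "stochastic_mat q P" and d: "d > 0" and \<pi>: "set_pmf \<pi> = {..<q}"
    and sd: "spectral_decomp q \<pi> P lam U" and \<delta>: "\<delta> > 0"
    and \<nu>: "lifts_moments q K \<nu>" "K \<le> 2 ^ m"
    and l: "l < q" "lam ! l \<ge> 0" "(lam ! l)\<^sup>2 * d > KS_const \<pi> q \<delta>"
  shows "\<exists>T. \<forall>i<q. measure_pmf.prob (view_law \<nu> d P (Suc m) i)
    {x. \<delta> / 2 \<le> \<bar>T x - eigvec \<pi> U l i\<bar>} \<le> 1 / (4 * real q)"
proof -
  define B where "B = (\<Sum>i<q. 1 / pmf \<pi> i)"
  define L where "L = (lam ! l)\<^sup>2 * d"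
  define s where "s = (d * lam ! l) ^ Suc m"
  have B0: "B \<ge> 0" unfolding B_def by (intro sum_nonneg) auto
  have L: "L > 2 + 48 * real q * B / \<delta>\<^sup>2" using l(3) by (simp add: L_def KS_const_def B_def)
  moreover have "48 * real q * B / \<delta>\<^sup>2 \<ge> 0" using B0 by simp
  ultimately have L2: "L \<ge> 2" and L48: "48 * real q * B / \<delta>\<^sup>2 \<le> L" by auto
  have "lam ! l \<noteq> 0" using L2 by (auto simp: L_def)
  then have s: "s > 0" using l(2) d unfolding s_def by simp
  have B: "(eigvec \<pi> U l i)\<^sup>2 \<le> B" if i: "i < q" for i
  proof -
    have "(eigvec \<pi> U l i)\<^sup>2 \<le> 1 / pmf \<pi> i" by (rule spectral_decomp_eigvec(2)[OF sd \<pi> l(1) i])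
    also have "\<dots> \<le> B" unfolding B_def using i by (intro member_le_sum) auto
    finally show ?thesis .
  qed
  with \<nu>(1) obtain \<eta> where \<eta>: "\<And>i. i < q \<Longrightarrow> \<exists>v\<le>K * B. quad_moments (\<nu> i) \<eta> (eigvec \<pi> U l i) v"
    unfolding lifts_moments_def by blast
  let ?T = "\<lambda>x. level_sum \<eta> (Suc m) x / s"
  have "measure_pmf.prob (view_law \<nu> d P (Suc m) i) {x. \<delta> / 2 \<le> \<bar>?T x - eigvec \<pi> U l i\<bar>}
      \<le> 1 / (4 * real q)" if i: "i < q" for i
  proof -
    let ?p = "view_law \<nu> d P (Suc m) i"
    from quad_moments_level_sum[OF P d spectral_decomp_eigvec(1)[OF sd \<pi> l(1)] L2[unfolded L_def] B \<eta> i,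
        where m = "Suc m"]
    obtain v where qm: "quad_moments ?p (level_sum \<eta> (Suc m)) (s * eigvec \<pi> U l i) v"
      and v: "v \<le> s\<^sup>2 * (2 * B / L + K * B / L ^ Suc m)"
      unfolding s_def L_def by blast
    have "K \<le> L ^ m" using \<nu>(2) power_mono[of 2 L m] L2 by linarith
    then have "K * B / L ^ Suc m \<le> L ^ m * B / L ^ Suc m"
      using B0 L2 by (intro divide_right_mono mult_right_mono) auto
    also have "\<dots> = B / L" using L2 by simp
    finally have "2 * B / L + K * B / L ^ Suc m \<le> 3 * B / L" by simp
    from mult_left_mono[OF this, of "s\<^sup>2"] v have v: "v \<le> s\<^sup>2 * (3 * B / L)" by simp
    have "{x. \<delta> / 2 \<le> \<bar>?T x - eigvec \<pi> U l i\<bar>}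
        = {x. s * (\<delta> / 2) \<le> \<bar>level_sum \<eta> (Suc m) x - s * eigvec \<pi> U l i\<bar>}"
    proof (intro Collect_cong)
      fix x
      have "level_sum \<eta> (Suc m) x - s * eigvec \<pi> U l i = s * (?T x - eigvec \<pi> U l i)"
        using s by (simp add: field_simps)
      then show "\<delta> / 2 \<le> \<bar>?T x - eigvec \<pi> U l i\<bar> \<longleftrightarrow>
          s * (\<delta> / 2) \<le> \<bar>level_sum \<eta> (Suc m) x - s * eigvec \<pi> U l i\<bar>"
        by (simp only: abs_mult abs_of_pos[OF s] mult_le_cancel_left_pos[OF s])
    qed
    then have "measure_pmf.prob ?p {x. \<delta> / 2 \<le> \<bar>?T x - eigvec \<pi> U l i\<bar>} \<le> v / (s * (\<delta> / 2))\<^sup>2"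
      using quad_moments_Chebyshev[OF qm mult_pos_pos[OF s half_gt_zero[OF \<delta>]]] by (simp only:)
    also have "\<dots> \<le> s\<^sup>2 * (3 * B / L) / (s * (\<delta> / 2))\<^sup>2"
      using v by (intro divide_right_mono) auto
    also have "\<dots> = 12 * B / (\<delta>\<^sup>2 * L)"
      using s \<delta> L2 by (simp add: power_mult_distrib power_divide field_simps)
    also have "\<dots> \<le> 1 / (4 * real q)"
    proof -
      have "48 * real q * B \<le> L * \<delta>\<^sup>2" using L48 \<delta> by (simp add: field_simps)
      then show ?thesis using i L2 \<delta> by (simp add: field_simps)
    qed
    finally show ?thesis .
  qed
  then show ?thesis by (intro exI[of _ ?T] allI impI)
qed

text \<open>Depth \<open>m + 1\<close> suffices to guess the label from the spectral statistics; the
  last generation is spent on the boost.\<close>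

lemma bhatt_view_law_le:
  assumes P: "stochastic_mat q P" and d: "d > 0" and \<pi>: "set_pmf \<pi> = {..<q}"
    and sd: "spectral_decomp q \<pi> P lam U" and \<delta>: "\<delta> > 0"
    and nn: "\<And>l. l < q \<Longrightarrow> lam ! l \<ge> 0"
    and dist: "distinguishable q \<delta> {eigvec \<pi> U l | l. l < q \<and> (lam ! l)\<^sup>2 * d > KS_const \<pi> q \<delta>}"
    and \<nu>: "lifts_moments q K \<nu>" "K \<le> 2 ^ m"
    and ij: "i < q" "j < q" and r: "0 \<le> r" "r \<le> row_dist1 q P i j"
  shows "bhatt (view_law \<nu> d P (m + 2) i) (view_law \<nu> d P (m + 2) j) \<le> ennreal (exp (- (r\<^sup>2 / 32 * d)))"
proof -
  define G where "G = {l. l < q \<and> (lam ! l)\<^sup>2 * d > KS_const \<pi> q \<delta>}"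
  have "\<forall>l\<in>G. \<exists>T. \<forall>i<q. measure_pmf.prob (view_law \<nu> d P (Suc m) i)
      {x. \<delta> / 2 \<le> \<bar>T x - eigvec \<pi> U l i\<bar>} \<le> 1 / (4 * real q)"
  proof
    fix l assume "l \<in> G"
    then have "l < q" "lam ! l \<ge> 0" "(lam ! l)\<^sup>2 * d > KS_const \<pi> q \<delta>" using nn by (auto simp: G_def)
    then show "\<exists>T. \<forall>i<q. measure_pmf.prob (view_law \<nu> d P (Suc m) i)
        {x. \<delta> / 2 \<le> \<bar>T x - eigvec \<pi> U l i\<bar>} \<le> 1 / (4 * real q)"
      by (rule prob_level_sum_deviation[OF P d \<pi> sd \<delta> \<nu>])
  qed
  then obtain T where T: "\<And>l i. l \<in> G \<Longrightarrow> i < q \<Longrightarrow> measure_pmf.prob (view_law \<nu> d P (Suc m) i)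
      {x. \<delta> / 2 \<le> \<bar>T l x - eigvec \<pi> U l i\<bar>} \<le> 1 / (4 * real q)"
    by (auto dest!: bchoice)
  have dst: "\<exists>l\<in>G. \<bar>eigvec \<pi> U l i - eigvec \<pi> U l j\<bar> > \<delta>" if "i < q" "j < q" "i \<noteq> j" for i j
    using dist that unfolding distinguishable_def G_def by blast
  have "G \<subseteq> {..<q}" by (auto simp: G_def)
  from ex_estimator[where \<xi> = "eigvec \<pi> U" and p = "view_law \<nu> d P (Suc m)" and T = T, OF this dst T] obtain f where
    f: "\<And>i. i < q \<Longrightarrow> measure_pmf.prob (view_law \<nu> d P (Suc m) i) {x. f x = i} \<ge> 3 / 4" by blast
  show ?thesis using bhatt_view_law_Suc[OF P d ij f r] by (simp only: add_2_eq_Suc')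
qed

section \<open>Guessing probabilities for clean and noisy labels\<close>

lemma
  assumes q: "2 \<le> q" and \<pi>: "set_pmf \<pi> = {..<q}" and \<delta>: "\<delta> > 0" and d: "d > 0"
    and P: "stochastic_mat q P" and sd: "spectral_decomp q \<pi> P lam U"
    and nn: "\<And>l. l < q \<Longrightarrow> lam ! l \<ge> 0"
    and rows: "\<And>i j. i < q \<Longrightarrow> j < q \<Longrightarrow> i \<noteq> j \<Longrightarrow> \<delta> * real q * lam ! 1 \<le> row_dist1 q P i j"
    and dist: "distinguishable q \<delta> {eigvec \<pi> U l | l. l < q \<and> (lam ! l)\<^sup>2 * d > KS_const \<pi> q \<delta>}"
  shows E_opt_ge: "2 \<le> k \<Longrightarrow>
      1 - real q * exp (- (\<delta>\<^sup>2 * (real q)\<^sup>2 / 32 * (lam ! 1)\<^sup>2 * d)) \<le> E_opt q \<pi> d P k"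
    and E_noisy_ge: "lifts_moments q K (row_pmf D) \<Longrightarrow> K \<le> 2 ^ n \<Longrightarrow> n + 2 \<le> k \<Longrightarrow>
      1 - real q * exp (- (\<delta>\<^sup>2 * (real q)\<^sup>2 / 32 * (lam ! 1)\<^sup>2 * d)) \<le> E_noisy q \<pi> d P D k"
proof -
  let ?e = "exp (- (\<delta>\<^sup>2 * (real q)\<^sup>2 / 32 * (lam ! 1)\<^sup>2 * d))"
  have q0: "q > 0" using q by simp
  have r0: "0 \<le> \<delta> * real q * lam ! 1" using \<delta> nn[of 1] q by simp
  have bh: "bhatt (view_law \<nu> d P k i) (view_law \<nu> d P k j) \<le> ennreal ?e"
    if \<nu>: "lifts_moments q K \<nu>" "K \<le> 2 ^ n" and k: "n + 2 \<le> k" and ij: "i < q" "j < q" "i \<noteq> j"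
    for \<nu> K n k i j
  proof -
    have k': "k - 2 + 2 = k" "n \<le> k - 2" using k by simp_all
    \<comment> \<open>A noise factor damped at depth \<open>n\<close> is damped at every greater
      depth, which gives the bound for all larger \<open>k\<close>.\<close>
    have "K \<le> 2 ^ (k - 2)" using \<nu>(2) power_increasing[OF k'(2), of "2 :: real"] by linarith
    from bhatt_view_law_le[OF P d \<pi> sd \<delta> nn dist \<nu>(1) this ij(1,2) r0 rows[OF ij]]
    show ?thesis unfolding k'(1) by (simp add: power_mult_distrib)
  qed
  \<comment> \<open>Clean labels lift with factor 0, so \<open>n = 0\<close> is admissible and two
    levels are enough.\<close>
  show "1 - real q * ?e \<le> E_opt q \<pi> d P k" if "2 \<le> k"
    unfolding E_opt_def posterior_def
    by (intro bayes_optimal_ge[OF clean_law_joint \<pi> q0] bh[OF lifts_moments_return, of 0])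
      (use that in auto)
  show "1 - real q * ?e \<le> E_noisy q \<pi> d P D k"
    if "lifts_moments q K (row_pmf D)" "K \<le> 2 ^ n" "n + 2 \<le> k"
    unfolding E_noisy_def noisy_posterior_def
    by (intro bayes_optimal_ge[OF noisy_law_joint \<pi> q0] bh[OF that]) auto
qed

text \<open>The relative noise variance at least halves per level, so depth is measured by powers of
  2. The choice is made from \<open>q\<close> and \<open>D\<close> alone, as a threshold fixed
  before all other data requires.\<close>

definition noise_depth :: "nat \<Rightarrow> real mat \<Rightarrow> nat" where
  "noise_depth q D = (SOME n. \<exists>K\<le>2 ^ n. lifts_moments q K (row_pmf D))"

lemma lifts_moments_noise_depth:
  assumes "stochastic_mat q D" "invertible_mat D"
  obtains K where "K \<le> 2 ^ noise_depth q D" "lifts_moments q K (row_pmf D)"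
proof -
  obtain K where K: "lifts_moments q K (row_pmf D)" using ex_lifts_moments_row_pmf[OF assms] ..
  obtain n where "K < 2 ^ n" using real_arch_pow[of 2 K] by auto
  with K have "\<exists>n. \<exists>K\<le>2 ^ n. lifts_moments q K (row_pmf D)" by (blast intro: less_imp_le)
  then have "\<exists>K\<le>2 ^ noise_depth q D. lifts_moments q K (row_pmf D)"
    unfolding noise_depth_def by (rule someI_ex)
  then show ?thesis using that by blast
qed

text \<open>The noisy bound has its own threshold \<open>k1\<close>, which may depend on
  \<open>D\<close>: inverting the noise costs a variance factor determined by \<open>D\<close>, and
  the depth that damps it is chosen accordingly. The constant and both thresholds are quantified
  first, so they depend on their arguments only.\<close>

theorem proposition1p15:
  "\<exists>(C :: nat pmf \<Rightarrow> nat \<Rightarrow> real \<Rightarrow> real)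
     (k0 :: real \<Rightarrow> real list \<Rightarrow> nat \<Rightarrow> nat)
     (k1 :: real \<Rightarrow> real list \<Rightarrow> nat \<Rightarrow> real mat \<Rightarrow> nat).
   \<forall>(q :: nat) (\<pi> :: nat pmf) (\<delta> :: real) (d :: real)
     (P :: real mat) (lam :: real list) (U :: real mat) (D :: real mat).
     q \<ge> 2 \<and> set_pmf \<pi> = {..<q} \<and> \<delta> > 0 \<and> d > 0 \<and>
     stochastic_mat q P \<and> reversible_mat q \<pi> P \<and>
     spectral_decomp q \<pi> P lam U \<and>
     lam ! 0 = 1 \<and> sorted_wrt (\<ge>) lam \<and> (\<forall>l<q. lam ! l \<ge> 0) \<and>
     (\<forall>i<q. \<forall>j<q. i \<noteq> j \<longrightarrow> row_dist1 q P i j \<ge> \<delta> * real q * lam ! 1) \<and>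
     stochastic_mat q D \<and> invertible_mat D \<and>
     distinguishable q \<delta> {eigvec \<pi> U l | l. l < q \<and> (lam ! l)\<^sup>2 * d > C \<pi> q \<delta>}
     \<longrightarrow>
       (\<forall>k \<ge> k0 d lam q.
          E_opt q \<pi> d P k
            \<ge> 1 - 2 * real q * exp (- (\<delta>\<^sup>2 * (real q)\<^sup>2 / 32 * (lam ! 1)\<^sup>2 * d))) \<and>
       (\<forall>k \<ge> k1 d lam q D.
          E_noisy q \<pi> d P D k
            \<ge> 1 - 2 * real q * exp (- (\<delta>\<^sup>2 * (real q)\<^sup>2 / 32 * (lam ! 1)\<^sup>2 * d)))"
proof (rule exI[of _ KS_const], rule exI[of _ "\<lambda>_ _ _. 2"],
    rule exI[of _ "\<lambda>_ _ q D. noise_depth q D + 2"], intro allI impI, elim conjE)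
  fix q \<pi> \<delta> d P lam U D
  assume H: "q \<ge> 2" "set_pmf \<pi> = {..<q}" "\<delta> > 0" "d > 0" "stochastic_mat q P" "spectral_decomp q \<pi> P lam U"
    and nn: "\<forall>l<q. lam ! l \<ge> 0"
    and rows: "\<forall>i<q. \<forall>j<q. i \<noteq> j \<longrightarrow> row_dist1 q P i j \<ge> \<delta> * real q * lam ! 1"
    and D: "stochastic_mat q D" "invertible_mat D"
    and dist: "distinguishable q \<delta> {eigvec \<pi> U l | l. l < q \<and> (lam ! l)\<^sup>2 * d > KS_const \<pi> q \<delta>}"
  let ?e = "exp (- (\<delta>\<^sup>2 * (real q)\<^sup>2 / 32 * (lam ! 1)\<^sup>2 * d))"
  \<comment> \<open>The Bayes bound has the factor \<open>q\<close>, half of what is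
    claimed.\<close>
  have weaken: "1 - 2 * real q * ?e \<le> 1 - real q * ?e" by simp
  note bounds = H nn[rule_format] rows[rule_format] dist
  show "(\<forall>k \<ge> 2. E_opt q \<pi> d P k \<ge> 1 - 2 * real q * ?e) \<and>
     (\<forall>k \<ge> noise_depth q D + 2. E_noisy q \<pi> d P D k \<ge> 1 - 2 * real q * ?e)"
  proof (intro conjI allI impI)
    fix k :: nat assume "k \<ge> 2"
    from weaken E_opt_ge[OF bounds this] show "E_opt q \<pi> d P k \<ge> 1 - 2 * real q * ?e"
      by (rule order_trans)
  next
    fix k assume "k \<ge> noise_depth q D + 2"
    moreover obtain K where "K \<le> 2 ^ noise_depth q D" "lifts_moments q K (row_pmf D)"
      by (rule lifts_moments_noise_depth[OF D])
    ultimately have "1 - real q * ?e \<le> E_noisy q \<pi> d P D k"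
      by (intro E_noisy_ge[OF bounds])
    with weaken show "E_noisy q \<pi> d P D k \<ge> 1 - 2 * real q * ?e" by (rule order_trans)
  qed
qed

end
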